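(* Let $\lambda\in\mathbb{R}$, $\Sigma=\{x\in\mathbb{R}^n : x_1<\lambda\}$, and let $x^\lambda=(2\lambda-x_1,x_2,\dots,x_n)$ denote the reflection of $x$ about the plane $\{x_1=\lambda\}$. Let $\Omega$ be a bounded narrow region in $\Sigma$, such that it is contained in $$\{x : \lambda-\delta<x_1<\lambda\}$$ with small $\delta$. Suppose that $w\in L_\alpha\cap C^{1,1}_{loc}(\Omega)$ and $w$ is lower semi-continuous on $\bar\Omega$. If $c(x)$ is bounded from below in $\Omega$ and $$ \begin{cases} (-\Delta)^{\alpha/2}w(x)+c(x)w(x)\ge 0 & \text{in } \Omega,\\ w(x)\ge 0 & \text{in } \Sigma\setminus\Omega,\\ w(x^\lambda)=-w(x) & \text{in } \Sigma, \end{cases} $$ then for sufficiently small $\delta$, we have $w(x)\ge 0$ in $\Omega$. Furthermore, if $w=0$ at some point in $\Omega$, then $w(x)=0$ almost everywhere in $\mathbb{R}^n$. These conclusions hold for an unbounded region $\Omega$ if we further assume that $\liminf_{|x|\to\infty}w(x)\ge 0$.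
   Context: $\alpha$ is a real number with $0<\alpha<2$. $L_\alpha=\{u:\mathbb{R}^n\to\mathbb{R} : \int_{\mathbb{R}^n}\frac{|u(x)|}{1+|x|^{n+\alpha}}\,dx<\infty\}$. $C^{1,1}_{loc}(\Omega)$ denotes functions that are differentiable on $\Omega$ with locally Lipschitz gradient. The fractional Laplacian is defined pointwise by $$(-\Delta)^{\alpha/2}u(x)=C_{n,\alpha}\lim_{\epsilon\to0}\int_{\mathbb{R}^n\setminus B_\epsilon(x)}\frac{u(x)-u(z)}{|x-z|^{n+\alpha}}\,dz,$$ where $C_{n,\alpha}$ is a normalization constant and $B_\epsilon(x)$ is the ball of radius $\epsilon$ centered at $x$. *)

theory Defs
  imports "HOL-Analysis.Analysis"
begin

text \<open>
  The distinguished (``first'') coordinate of \<open>real ^ 'n\<close> is given by an index \<open>k :: 'n\<close>;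
  the dimension is \<open>CARD('n)\<close>.
\<close>

definition left_half_space :: "'n::finite \<Rightarrow> real \<Rightarrow> (real ^ 'n) set" where
  "left_half_space k l = {x. x $ k < l}"

definition plane_reflect :: "'n::finite \<Rightarrow> real \<Rightarrow> real ^ 'n \<Rightarrow> real ^ 'n" where
  "plane_reflect k l x = (\<chi> i. if i = k then 2 * l - x $ k else x $ i)"

definition L_space :: "real \<Rightarrow> (real ^ 'n::finite \<Rightarrow> real) set" where
  "L_space \<alpha> = {u \<in> borel_measurable lebesgue.
     integrable lebesgue (\<lambda>x. \<bar>u x\<bar> / (1 + norm x powr (real CARD('n) + \<alpha>)))}"

definition C11_loc :: "'a::real_inner set \<Rightarrow> ('a \<Rightarrow> real) set" where
  "C11_loc \<Omega> = {u. \<exists>G. (\<forall>x\<in>\<Omega>. GDERIV u x :> G x) \<and>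
     (\<forall>x\<in>\<Omega>. \<exists>r>0. \<exists>C. C-lipschitz_on (ball x r \<inter> \<Omega>) G)}"

definition lower_semicontinuous_on ::
    "'a::topological_space set \<Rightarrow> ('a \<Rightarrow> real) \<Rightarrow> bool" where
  "lower_semicontinuous_on S f \<longleftrightarrow> (\<forall>x\<in>S. \<forall>a<f x. \<forall>\<^sub>F y in at x within S. a < f y)"

text \<open>
  The normalization for which the operator below has Fourier symbol \<open>\<bar>\<xi>\<bar> powr \<alpha>\<close>;
  it is positive for \<open>0 < \<alpha> < 2\<close>.
\<close>

definition frac_laplacian_const :: "nat \<Rightarrow> real \<Rightarrow> real" where
  "frac_laplacian_const n \<alpha> =
     2 powr \<alpha> * Gamma ((real n + \<alpha>) / 2) / (pi powr (real n / 2) * \<bar>Gamma (- \<alpha> / 2)\<bar>)"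

text \<open>
  \<open>frac_laplacian \<alpha>\<close> is \<open>(- \<Delta>)\<close> to the power \<open>\<alpha> / 2\<close>. Bochner integrals and \<^const>\<open>Lim\<close> are total;
  the truncated integrals converge absolutely and the principal value exists at every point
  of an open set \<open>\<Omega>\<close> if \<open>0 < \<alpha> < 2\<close> and \<open>u \<in> L_space \<alpha> \<inter> C11_loc \<Omega>\<close>.
\<close>

definition frac_laplacian :: "real \<Rightarrow> (real ^ 'n::finite \<Rightarrow> real) \<Rightarrow> real ^ 'n \<Rightarrow> real" where
  "frac_laplacian \<alpha> u x = frac_laplacian_const CARD('n) \<alpha> *
     Lim (at_right 0) (\<lambda>\<epsilon>. LINT z : - ball x \<epsilon> | lebesgue.
       (u x - u z) / norm (x - z) powr (real CARD('n) + \<alpha>))"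

end

theory Submission
  imports Defs
begin

text \<open>
  Write \<open>y\<^sup>*\<close> for the mirror image of \<open>y\<close> and \<open>d\<close> for the distance of \<open>y\<close> from the hyperplane.
  Antisymmetry turns the principal value at \<open>y\<close> into an integral over the half space of
  \<open>(w y - w z) k(y, z) + (w y + w z) k(y\<^sup>*, z)\<close>, that is, of
  \<open>(w y - w z) (k(y, z) - k(y\<^sup>*, z)) + 2 w y k(y\<^sup>*, z)\<close>, where \<open>k(y, z) > k(y\<^sup>*, z)\<close>.
  At a negative minimum the first term is nonpositive and the second contributes at most a
  negative multiple of \<open>\<bar>w y\<bar> d powr - \<alpha>\<close>, which beats \<open>c y * w y\<close> once \<open>d\<close> is small.
  Since the infimum need not be attained, \<open>y\<close> is taken to be a point where \<open>w\<close> is touched from below by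
  a paraboloid of small height on a ball of radius comparable with \<open>d\<close>; by scaling, the error is a
  small multiple of \<open>\<bar>w y\<bar> d powr - \<alpha>\<close>. If \<open>w \<ge> 0\<close> vanishes at \<open>y\<close>, the folded integrand
  is \<open>- w z (k(y, z) - k(y\<^sup>*, z))\<close>, so it must vanish almost everywhere.
\<close>

subsection \<open>Integrals of the Riesz kernel\<close>

text \<open>Stands in for polar coordinates: sum and integral are exchanged, the \<open>j\<close>-th
  ball contributes the unit ball volume times \<open>a j * b j ^ DIM('a)\<close>, and a geometric
  series bounds the total.\<close>

lemma nn_integral_le_geometric_balls:
  fixes f :: "'a::euclidean_space \<Rightarrow> ennreal"
  assumes f: "\<And>z. f z \<le> (\<Sum>j. ennreal (a j) * indicator (ball y (b j)) z)"
    and a: "\<And>j. 0 \<le> a j" and b: "\<And>j. 0 \<le> b j"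
    and M: "\<And>j. a j * b j ^ DIM('a) \<le> M * q ^ j" and q: "0 \<le> q" "q < 1"
  shows "(\<integral>\<^sup>+z. f z \<partial>lebesgue) \<le> ennreal (unit_ball_vol (DIM('a)) * M / (1 - q))"
proof -
  let ?V = "unit_ball_vol (DIM('a))"
  have V: "0 \<le> ?V" by simp
  have "0 \<le> a 0 * b 0 ^ DIM('a)" using a b by simp
  also have "\<dots> \<le> M" using M[of 0] by simp
  finally have M0: "0 \<le> M" .
  have "(\<integral>\<^sup>+z. f z \<partial>lebesgue) \<le> (\<integral>\<^sup>+z. (\<Sum>j. ennreal (a j) * indicator (ball y (b j)) z) \<partial>lebesgue)"
    by (intro nn_integral_mono f)
  also have "\<dots> = (\<Sum>j. \<integral>\<^sup>+z. ennreal (a j) * indicator (ball y (b j)) z \<partial>lebesgue)"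
    by (intro nn_integral_suminf measurable_completion borel_measurable_times_ennreal
        borel_measurable_const borel_measurable_indicator) simp
  also have "\<dots> = (\<Sum>j. ennreal (a j) * emeasure lborel (ball y (b j)))"
    by (subst nn_integral_cmult_indicator) auto
  also have "\<dots> = (\<Sum>j. ennreal (?V * (a j * b j ^ DIM('a))))"
  proof (intro suminf_cong)
    fix j
    have "ennreal (a j) * emeasure lborel (ball y (b j)) = ennreal (a j) * ennreal (?V * b j ^ DIM('a))"
      by (simp only: emeasure_ball[OF b])
    also have "\<dots> = ennreal (?V * (a j * b j ^ DIM('a)))"
      using a b V by (subst ennreal_mult[symmetric]) (auto simp: mult_ac)
    finally show "ennreal (a j) * emeasure lborel (ball y (b j)) = ennreal (?V * (a j * b j ^ DIM('a)))" .
  qed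
  also have "\<dots> \<le> (\<Sum>j. ennreal (?V * M * q ^ j))"
    using M V by (intro suminf_le ennreal_leI) (auto intro!: mult_left_mono simp: mult.assoc)
  also have "\<dots> = ennreal (\<Sum>j. ?V * M * q ^ j)"
    using q M0 V by (intro suminf_ennreal2) (auto intro!: summable_mult summable_geometric)
  also have "(\<Sum>j. ?V * M * q ^ j) = ?V * M / (1 - q)"
    using q by (simp add: suminf_mult suminf_geometric summable_geometric)
  finally show ?thesis .
qed

lemma integrable_le_of_nn_integral_le:
  fixes f :: "'a \<Rightarrow> real"
  assumes "f \<in> borel_measurable M" "\<And>x. 0 \<le> f x" "(\<integral>\<^sup>+x. ennreal (f x) \<partial>M) \<le> ennreal B" "0 \<le> B"
  shows "integrable M f \<and> integral\<^sup>L M f \<le> B"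
proof -
  have i: "integrable M f"
    using assms by (intro integrableI_nonneg) (auto simp: le_less_trans[OF _ ennreal_less_top])
  have "ennreal (integral\<^sup>L M f) = (\<integral>\<^sup>+x. ennreal (f x) \<partial>M)"
    using i assms by (intro nn_integral_eq_integral[symmetric]) auto
  then show ?thesis using i assms by (metis ennreal_le_iff)
qed

text \<open>At \<open>z = y\<close> the value is 0, because \<open>0 powr p = 0\<close> and division
  by zero yields 0; strict comparisons between kernels must therefore exclude the diagonal.\<close>

definition riesz_kernel :: "real \<Rightarrow> 'a::real_normed_vector \<Rightarrow> 'a \<Rightarrow> real" where
  "riesz_kernel p y z = 1 / norm (y - z) powr p"

lemma riesz_kernel_nonneg [simp]: "0 \<le> riesz_kernel p y z"
  by (simp add: riesz_kernel_def)

lemma riesz_kernel_measurable [measurable]: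
  "riesz_kernel p y \<in> borel_measurable (lebesgue :: 'a::euclidean_space measure)"
proof -
  have "riesz_kernel p y \<in> borel_measurable (borel :: 'a measure)"
    unfolding riesz_kernel_def[abs_def] by measurable
  then show ?thesis by (intro measurable_completion) simp
qed

text \<open>Selects the dyadic shell outside radius \<open>s\<close> that contains a point at
  distance \<open>t\<close>. The least \<open>j\<close> with \<open>t < 2 ^ Suc j * s\<close> works:
  its minimality gives the lower bound.\<close>

lemma ex_dyadic_above:
  assumes "(0::real) < s" "s \<le> t"
  shows "\<exists>j. 2 ^ j * s \<le> t \<and> t < 2 ^ Suc j * s"
proof -
  obtain i where "t < 2 ^ i * s"
    using real_arch_pow[of 2 "t / s"] assms by (auto simp: field_simps)
  also have "\<dots> \<le> 2 ^ Suc i * s" using assms by simp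
  finally have ex: "\<exists>j. t < 2 ^ Suc j * s" by blast
  define j where "j = (LEAST j. t < 2 ^ Suc j * s)"
  have 1: "t < 2 ^ Suc j * s" unfolding j_def by (rule LeastI_ex[OF ex])
  have "2 ^ j * s \<le> t"
  proof (cases j)
    case 0 then show ?thesis using assms by simp
  next
    case (Suc i)
    then have "\<not> t < 2 ^ Suc i * s" using not_less_Least[of i "\<lambda>j. t < 2 ^ Suc j * s"] j_def by simp
    then show ?thesis using Suc by simp
  qed
  with 1 show ?thesis by blast
qed

text \<open>Counterpart for shells that shrink towards the centre; they never reach it, so
  \<open>t\<close> is positive.\<close>

lemma ex_dyadic_below:
  assumes "(0::real) < t" "t < s"
  shows "\<exists>j. s / 2 ^ Suc j \<le> t \<and> t < s / 2 ^ j"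
proof -
  obtain i where "s / t < 2 ^ i"
    using real_arch_pow[of 2 "s / t"] by auto
  also have "(2::real) ^ i \<le> 2 ^ Suc i" by simp
  finally have ex: "\<exists>j. s / 2 ^ Suc j \<le> t" using assms by (auto simp: field_simps intro!: exI[of _ i])
  define j where "j = (LEAST j. s / 2 ^ Suc j \<le> t)"
  have 1: "s / 2 ^ Suc j \<le> t" unfolding j_def by (rule LeastI_ex[OF ex])
  have "t < s / 2 ^ j"
  proof (cases j)
    case 0 then show ?thesis using assms by simp
  next
    case (Suc i)
    then have "\<not> s / 2 ^ Suc i \<le> t" using not_less_Least[of i "\<lambda>j. s / 2 ^ Suc j \<le> t"] j_def by simp
    then show ?thesis using Suc by simp
  qed
  with 1 show ?thesis by blast
qed

lemma le_suminf_ennreal_term: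
  fixes F :: "nat \<Rightarrow> ennreal"
  assumes "x \<le> F j"
  shows "x \<le> (\<Sum>j. F j)"
  using assms sum_le_suminf[of F "{j}"] by (auto intro: order_trans)

text \<open>On the \<open>j\<close>-th shell the kernel is at most
  \<open>(2 ^ j * s) powr - p\<close>. Times the volume of the enclosing ball, this is a multiple of
  \<open>s powr - \<alpha> * (2 powr - \<alpha>) ^ j\<close>, summable because \<alpha> is
  positive.\<close>

lemma riesz_kernel_tail_integral:
  assumes "0 < \<alpha>"
  defines "p \<equiv> real (DIM('a)) + \<alpha>"
  shows "\<exists>C\<ge>0. \<forall>(y::'a::euclidean_space) s. 0 < s \<longrightarrow>
    set_integrable lebesgue (- ball y s) (riesz_kernel p y) \<and>
    (LINT z : - ball y s | lebesgue. riesz_kernel p y z) \<le> C * s powr - \<alpha>"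
proof (intro exI conjI allI impI)
  let ?n = "DIM('a)"
  let ?C = "unit_ball_vol ?n * 2 ^ ?n / (1 - 2 powr - \<alpha>)"
  have q: "0 \<le> 2 powr - \<alpha>" "2 powr - \<alpha> < 1" using assms powr_less_one by (auto simp: powr_less_one)
  show C: "0 \<le> ?C" using q by simp
  fix y :: 'a and s :: real assume s: "0 < s"
  have nn: "(\<integral>\<^sup>+z. ennreal (indicator (- ball y s) z *\<^sub>R riesz_kernel p y z) \<partial>lebesgue)
    \<le> ennreal (unit_ball_vol ?n * (2 ^ ?n * s powr - \<alpha>) / (1 - 2 powr - \<alpha>))"
  proof (rule nn_integral_le_geometric_balls[where y = y and b = "\<lambda>j. 2 ^ Suc j * s"
        and a = "\<lambda>j. (2 ^ j * s) powr - p"])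
    fix z
    show "ennreal (indicator (- ball y s) z *\<^sub>R riesz_kernel p y z)
      \<le> (\<Sum>j. ennreal ((2 ^ j * s) powr - p) * indicator (ball y (2 ^ Suc j * s)) z)"
    proof (cases "z \<in> ball y s")
      case False
      then obtain j where j: "2 ^ j * s \<le> norm (y - z)" "norm (y - z) < 2 ^ Suc j * s"
        using ex_dyadic_above[OF s, of "norm (y - z)"] by (auto simp: dist_norm)
      have "riesz_kernel p y z \<le> (2 ^ j * s) powr - p"
        unfolding riesz_kernel_def powr_minus_divide
        using j s assms False by (intro divide_left_mono powr_mono2) (auto simp: p_def intro!: mult_pos_pos)
      then show ?thesis using False j
        by (intro le_suminf_ennreal_term[where j = j]) (auto simp: dist_norm ennreal_leI)
    qed auto
  next
    fix j
    have "(2 ^ j * s) powr - p * (2 ^ Suc j * s) ^ ?n = 2 ^ ?n * ((2 ^ j * s) powr - p * (2 ^ j * s) powr ?n)"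
      using s by (simp add: powr_realpow power_mult_distrib mult_ac)
    also have "(2 ^ j * s) powr - p * (2 ^ j * s) powr ?n = (2 ^ j * s) powr - \<alpha>"
      by (simp add: powr_add[symmetric] p_def)
    also have "\<dots> = s powr - \<alpha> * (2 powr - \<alpha>) ^ j"
      using s by (simp add: powr_mult powr_realpow[symmetric] powr_powr mult_ac)
    finally show "(2 ^ j * s) powr - p * (2 ^ Suc j * s) ^ ?n \<le> 2 ^ ?n * s powr - \<alpha> * (2 powr - \<alpha>) ^ j"
      by (simp add: mult_ac)
  qed (use s q in auto)
  have nonneg: "indicator (- ball y s) z *\<^sub>R riesz_kernel p y z \<ge> 0" for z by simp
  have meas: "(\<lambda>z. indicator (- ball y s) z *\<^sub>R riesz_kernel p y z) \<in> borel_measurable lebesgue"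
    by (intro borel_measurable_scaleR borel_measurable_indicator) auto
  have eq: "unit_ball_vol ?n * (2 ^ ?n * s powr - \<alpha>) / (1 - 2 powr - \<alpha>) = ?C * s powr - \<alpha>" by simp
  have "integrable lebesgue (\<lambda>z. indicator (- ball y s) z *\<^sub>R riesz_kernel p y z) \<and>
     (LINT z|lebesgue. indicator (- ball y s) z *\<^sub>R riesz_kernel p y z) \<le> ?C * s powr - \<alpha>"
    by (rule integrable_le_of_nn_integral_le[OF meas nonneg nn[unfolded eq]])
      (rule mult_nonneg_nonneg[OF C powr_ge_zero])
  then show "set_integrable lebesgue (- ball y s) (riesz_kernel p y)"
    "(LINT z : - ball y s | lebesgue. riesz_kernel p y z) \<le> ?C * s powr - \<alpha>"
    by (simp_all add: set_integrable_def set_lebesgue_integral_def)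
qed

text \<open>The squared distance weakens the singularity: the \<open>j\<close>-th inward shell
  contributes a multiple of \<open>s powr (2 - \<alpha>) * (2 powr - (2 - \<alpha>)) ^ j\<close>,
  summable because \<open>\<alpha> < 2\<close>.\<close>

lemma riesz_kernel_second_moment:
  assumes "0 < \<alpha>" "\<alpha> < 2"
  defines "p \<equiv> real (DIM('a)) + \<alpha>"
  shows "\<exists>C\<ge>0. \<forall>(y::'a::euclidean_space) s. 0 < s \<longrightarrow>
    set_integrable lebesgue (ball y s) (\<lambda>z. (norm (y - z))\<^sup>2 * riesz_kernel p y z) \<and>
    (LINT z : ball y s | lebesgue. (norm (y - z))\<^sup>2 * riesz_kernel p y z) \<le> C * s powr (2 - \<alpha>)"
proof (intro exI conjI allI impI)
  let ?n = "DIM('a)"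
  let ?q = "2 powr - (2 - \<alpha>)"
  let ?C = "unit_ball_vol ?n * 2 powr p / (1 - ?q)"
  have q: "0 \<le> ?q" "?q < 1" using assms powr_less_one[of 2 "- (2 - \<alpha>)"] by auto
  show C: "0 \<le> ?C" using q by simp
  fix y :: 'a and s :: real assume s: "0 < s"
  let ?f = "\<lambda>z. (norm (y - z))\<^sup>2 * riesz_kernel p y z"
  have nn: "(\<integral>\<^sup>+z. ennreal (indicator (ball y s) z *\<^sub>R ?f z) \<partial>lebesgue)
    \<le> ennreal (unit_ball_vol ?n * (2 powr p * s powr (2 - \<alpha>)) / (1 - ?q))"
  proof (rule nn_integral_le_geometric_balls[where y = y and b = "\<lambda>j. s / 2 ^ j"
        and a = "\<lambda>j. (s / 2 ^ j)\<^sup>2 * (s / 2 ^ Suc j) powr - p"])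
    fix z
    show "ennreal (indicator (ball y s) z *\<^sub>R ?f z)
      \<le> (\<Sum>j. ennreal ((s / 2 ^ j)\<^sup>2 * (s / 2 ^ Suc j) powr - p) * indicator (ball y (s / 2 ^ j)) z)"
    proof (cases "z \<in> ball y s \<and> z \<noteq> y")
      case True
      then obtain j where j: "s / 2 ^ Suc j \<le> norm (y - z)" "norm (y - z) < s / 2 ^ j"
        using ex_dyadic_below[of "norm (y - z)" s] by (auto simp: dist_norm)
      have "riesz_kernel p y z \<le> (s / 2 ^ Suc j) powr - p"
        unfolding riesz_kernel_def powr_minus_divide
        using j s assms True by (intro divide_left_mono powr_mono2) (auto simp: p_def intro!: mult_pos_pos)
      then have "?f z \<le> (s / 2 ^ j)\<^sup>2 * (s / 2 ^ Suc j) powr - p"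
        using j by (intro mult_mono power_mono) auto
      then show ?thesis using True j
        by (intro le_suminf_ennreal_term[where j = j]) (auto simp: dist_norm ennreal_leI)
    qed auto
  next
    fix j
    define t where "t = s / 2 ^ j"
    have t: "0 < t" using s by (simp add: t_def)
    \<comment> \<open>The kernel is estimated at the inner radius \<open>t / 2\<close> of the shell,
      which costs a factor \<open>2 powr p\<close>.\<close>
    have "(s / 2 ^ Suc j) powr - p = 2 powr p * t powr - p"
    proof -
      have "s / 2 ^ Suc j = t / 2" by (simp add: t_def)
      then show ?thesis using t by (simp add: powr_divide powr_minus field_simps)
    qed
    then have "(s / 2 ^ j)\<^sup>2 * (s / 2 ^ Suc j) powr - p * (s / 2 ^ j) ^ ?n
      = 2 powr p * (t powr 2 * t powr - p * t powr ?n)"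
      using t by (simp add: powr_realpow t_def[symmetric])
    also have "t powr 2 * t powr - p * t powr ?n = t powr (2 - \<alpha>)"
      by (simp add: powr_add[symmetric] p_def)
    also have "t = s * 2 powr (- real j)" by (simp add: t_def powr_minus powr_realpow field_simps)
    also have "\<dots> powr (2 - \<alpha>) = s powr (2 - \<alpha>) * ?q ^ j"
      using s by (simp add: powr_mult powr_realpow[symmetric] powr_powr algebra_simps)
    finally show "(s / 2 ^ j)\<^sup>2 * (s / 2 ^ Suc j) powr - p * (s / 2 ^ j) ^ ?n
        \<le> 2 powr p * s powr (2 - \<alpha>) * ?q ^ j"
      by (simp add: mult_ac)
  qed (use s q in auto)
  have nonneg: "indicator (ball y s) z *\<^sub>R ?f z \<ge> 0" for z by simp
  have meas: "(\<lambda>z. indicator (ball y s) z *\<^sub>R ?f z) \<in> borel_measurable lebesgue"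
    by (intro borel_measurable_scaleR borel_measurable_indicator borel_measurable_times
        riesz_kernel_measurable measurable_completion) auto
  have eq: "unit_ball_vol ?n * (2 powr p * s powr (2 - \<alpha>)) / (1 - ?q) = ?C * s powr (2 - \<alpha>)" by simp
  have "integrable lebesgue (\<lambda>z. indicator (ball y s) z *\<^sub>R ?f z) \<and>
     (LINT z|lebesgue. indicator (ball y s) z *\<^sub>R ?f z) \<le> ?C * s powr (2 - \<alpha>)"
    by (rule integrable_le_of_nn_integral_le[OF meas nonneg nn[unfolded eq]])
      (rule mult_nonneg_nonneg[OF C powr_ge_zero])
  then show "set_integrable lebesgue (ball y s) ?f"
    "(LINT z : ball y s | lebesgue. ?f z) \<le> ?C * s powr (2 - \<alpha>)"
    by (simp_all add: set_integrable_def set_lebesgue_integral_def)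
qed

subsection \<open>Reflections\<close>

text \<open>A translation composed with sign changes of coordinates has Jacobian of absolute value
  1. Reflections in a point and in a coordinate hyperplane are both of this form.\<close>

lemma lebesgue_flip:
  fixes c :: "'a::euclidean_space \<Rightarrow> real"
  assumes c: "\<And>j. j \<in> Basis \<Longrightarrow> \<bar>c j\<bar> = 1"
    and T: "\<And>x. T x = t + (\<Sum>j\<in>Basis. (c j * (x \<bullet> j)) *\<^sub>R j)"
  shows "T \<in> lebesgue \<rightarrow>\<^sub>M lebesgue" and "distr lebesgue lebesgue T = lebesgue"
proof -
  have T': "T = (\<lambda>x. t + (\<Sum>j\<in>Basis. (c j * (x \<bullet> j)) *\<^sub>R j))" using T by auto
  have c0: "\<And>j. j \<in> Basis \<Longrightarrow> c j \<noteq> 0" using c by force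
  show "T \<in> lebesgue \<rightarrow>\<^sub>M lebesgue"
    unfolding T' by (rule lebesgue_affine_measurable[OF c0])
  have "lebesgue = density (distr lebesgue lebesgue T) (\<lambda>_. (\<Prod>j\<in>Basis. \<bar>c j\<bar>))"
    unfolding T' by (rule lebesgue_affine_euclidean[OF c0])
  also have "(\<Prod>j\<in>Basis. \<bar>c j\<bar>) = 1" using c by simp
  finally show "distr lebesgue lebesgue T = lebesgue" by (simp add: density_1)
qed

lemma lebesgue_point_reflect:
  fixes y :: "'a::euclidean_space"
  shows "(\<lambda>x. 2 *\<^sub>R y - x) \<in> lebesgue \<rightarrow>\<^sub>M lebesgue"
    and "distr lebesgue lebesgue (\<lambda>x. 2 *\<^sub>R y - x) = lebesgue"
proof -
  have "2 *\<^sub>R y - x = 2 *\<^sub>R y + (\<Sum>j\<in>Basis. (-1 * (x \<bullet> j)) *\<^sub>R j)" for x :: 'a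
    by (simp add: sum_negf euclidean_representation)
  from lebesgue_flip[OF _ this]
  show "(\<lambda>x. 2 *\<^sub>R y - x) \<in> lebesgue \<rightarrow>\<^sub>M lebesgue"
    and "distr lebesgue lebesgue (\<lambda>x. 2 *\<^sub>R y - x) = lebesgue" by auto
qed

text \<open>The point reflection preserves Lebesgue measure, so the integral equals its own
  negative.\<close>

lemma integral_odd_about_point:
  fixes f :: "'a::euclidean_space \<Rightarrow> real"
  assumes f: "integrable lebesgue f" and odd: "\<And>z. f (2 *\<^sub>R y - z) = - f z"
  shows "integral\<^sup>L lebesgue f = 0"
proof -
  have "integral\<^sup>L lebesgue f = integral\<^sup>L (distr lebesgue lebesgue (\<lambda>x. 2 *\<^sub>R y - x)) f"
    by (simp add: lebesgue_point_reflect)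
  also have "\<dots> = (LINT z|lebesgue. f (2 *\<^sub>R y - z))"
    using f by (intro integral_distr lebesgue_point_reflect) auto
  also have "\<dots> = - integral\<^sup>L lebesgue f" by (simp add: odd)
  finally show ?thesis by simp
qed

lemma plane_reflect_component [simp]:
  "plane_reflect k l x $ i = (if i = k then 2 * l - x $ k else x $ i)"
  by (simp add: plane_reflect_def)

lemma plane_reflect_involutive [simp]: "plane_reflect k l (plane_reflect k l x) = x"
  by (simp add: vec_eq_iff)

lemma lebesgue_plane_reflect:
  fixes k :: "'n::finite"
  shows "plane_reflect k l \<in> lebesgue \<rightarrow>\<^sub>M lebesgue"
    and "distr lebesgue lebesgue (plane_reflect k l) = lebesgue"
proof -
  \<comment> \<open>A sign change in coordinate \<open>k\<close> only, followed by a translation by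
    \<open>2 * l\<close> along that axis.\<close>
  have *: "plane_reflect k l x = axis k (2 * l) +
    (\<Sum>j\<in>Basis. ((if j = axis k 1 then -1 else 1) * (x \<bullet> j)) *\<^sub>R j)" for x
  proof (rule vec_eq_iff[THEN iffD2], rule allI)
    fix i
    have "(\<Sum>j\<in>Basis. ((if j = axis k 1 then -1 else 1) * (x \<bullet> j)) *\<^sub>R j) $ i
      = (\<Sum>j\<in>Basis. ((if j = axis k 1 then -1 else 1) * (x \<bullet> j)) *\<^sub>R j) \<bullet> axis i 1"
      by (simp add: inner_axis)
    also have "\<dots> = (if axis i 1 = (axis k 1 :: real ^ 'n) then -1 else 1) * (x \<bullet> axis i 1)"
      by (subst inner_sum_left_Basis) auto
    finally show "plane_reflect k l x $ i = (axis k (2 * l) +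
      (\<Sum>j\<in>Basis. ((if j = axis k 1 then -1 else 1) * (x \<bullet> j)) *\<^sub>R j)) $ i"
      by (auto simp: inner_axis axis_eq_axis) (auto simp: axis_def)
  qed
  from lebesgue_flip[OF _ *] show "plane_reflect k l \<in> lebesgue \<rightarrow>\<^sub>M lebesgue"
    and "distr lebesgue lebesgue (plane_reflect k l) = lebesgue" by auto
qed

lemma sets_lebesgue_left_half_space [measurable]: "left_half_space k l \<in> sets lebesgue"
proof -
  have "open (left_half_space k l)"
    unfolding left_half_space_def by (simp add: open_halfspace_component_lt_cart)
  then show ?thesis by auto
qed

lemma integrable_plane_reflect:
  assumes "integrable lebesgue (F :: real ^ 'n::finite \<Rightarrow> real)"
  shows "integrable lebesgue (\<lambda>z. F (plane_reflect k l z))"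
  using assms integrable_distr_eq[OF lebesgue_plane_reflect(1)[of k l], of F]
  by (simp add: lebesgue_plane_reflect(2) borel_measurable_integrable)

lemma integral_plane_reflect:
  assumes "integrable lebesgue (F :: real ^ 'n::finite \<Rightarrow> real)"
  shows "(LINT z|lebesgue. F (plane_reflect k l z)) = integral\<^sup>L lebesgue F"
  using assms integral_distr[OF lebesgue_plane_reflect(1)[of k l], of F]
  by (simp add: lebesgue_plane_reflect(2) borel_measurable_integrable)

lemma AE_not_on_plane: "AE x in lebesgue. (x :: real ^ 'n::finite) $ k \<noteq> l"
proof -
  have "negligible {x :: real ^ 'n. axis k 1 \<bullet> x = l}"
    by (rule negligible_hyperplane) (simp add: axis_eq_0_iff)
  then show ?thesis
    by (auto simp: negligible_iff_null_sets eventually_ae_filter inner_axis' )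
qed

text \<open>Up to the null hyperplane, the complement of the half space is its mirror image.\<close>

lemma integral_fold_left_half_space:
  assumes F: "integrable lebesgue (F :: real ^ 'n::finite \<Rightarrow> real)"
  shows "integral\<^sup>L lebesgue F = (LINT z : left_half_space k l | lebesgue. F z)
      + (LINT z : left_half_space k l | lebesgue. F (plane_reflect k l z))"
proof -
  let ?S = "left_half_space k l" and ?R = "plane_reflect k l"
  have i1: "integrable lebesgue (\<lambda>z. indicator ?S z *\<^sub>R F z)"
    by (rule integrable_mult_indicator[OF sets_lebesgue_left_half_space F])
  have i2: "integrable lebesgue (\<lambda>z. indicator (- ?S) z *\<^sub>R F z)"
    by (rule integrable_mult_indicator[OF _ F]) (simp add: Compl_in_sets_lebesgue)
  have i3: "integrable lebesgue (\<lambda>z. indicator ?S z *\<^sub>R F (?R z))"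
    by (rule integrable_mult_indicator[OF sets_lebesgue_left_half_space integrable_plane_reflect[OF F]])
  have "integral\<^sup>L lebesgue F = (LINT z|lebesgue. indicator ?S z *\<^sub>R F z + indicator (- ?S) z *\<^sub>R F z)"
    by (intro Bochner_Integration.integral_cong) (auto simp: indicator_def)
  also have "\<dots> = (LINT z|lebesgue. indicator ?S z *\<^sub>R F z) + (LINT z|lebesgue. indicator (- ?S) z *\<^sub>R F z)"
    using i1 i2 by (rule Bochner_Integration.integral_add)
  also have "(LINT z|lebesgue. indicator (- ?S) z *\<^sub>R F z)
      = (LINT z|lebesgue. indicator (- ?S) (?R z) *\<^sub>R F (?R z))"
    using integral_plane_reflect[OF i2] by simp
  also have "\<dots> = (LINT z|lebesgue. indicator ?S z *\<^sub>R F (?R z))"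
  proof (rule integral_cong_AE)
    show "AE z in lebesgue. indicator (- ?S) (?R z) *\<^sub>R F (?R z) = indicator ?S z *\<^sub>R F (?R z)"
      using AE_not_on_plane[of k l] by eventually_elim (auto simp: left_half_space_def indicator_def)
  qed (use integrable_plane_reflect[OF i2, of k l] i3 in auto)
  finally show "integral\<^sup>L lebesgue F = (LINT z : ?S | lebesgue. F z) + (LINT z : ?S | lebesgue. F (?R z))"
    by (simp add: set_lebesgue_integral_def)
qed

section \<open>Comparison of the kernel with its reflection\<close>

lemma norm_plane_reflect_diff:
  "norm (y - plane_reflect k l z) = norm (plane_reflect k l y - z)"
  unfolding norm_vec_def L2_set_def
  by (intro arg_cong[where f = sqrt] sum.cong) (auto simp: power2_eq_square algebra_simps)

lemma riesz_kernel_plane_reflect: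
  "riesz_kernel p y (plane_reflect k l z) = riesz_kernel p (plane_reflect k l y) z"
  by (simp add: riesz_kernel_def norm_plane_reflect_diff)

text \<open>The \<open>k\<close>-th coordinate of the mirror image of \<open>y\<close> is
  \<open>l + (l - y $ k)\<close>, while \<open>z $ k < l\<close>. For \<open>y\<close> in the half
  space this keeps the reflected kernel nonsingular there.\<close>

lemma dist_plane_reflect_ge:
  assumes "z \<in> left_half_space k l"
  shows "l - y $ k \<le> norm (plane_reflect k l y - z)"
proof -
  have "l - y $ k \<le> \<bar>(plane_reflect k l y - z) $ k\<bar>"
    using assms by (auto simp: left_half_space_def)
  also have "\<dots> \<le> norm (plane_reflect k l y - z)" by (rule component_le_norm_cart)
  finally show ?thesis .
qed

text \<open>The squared distances differ only through coordinate \<open>k\<close>, by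
  \<open>4 * (l - y $ k) * (l - z $ k)\<close>.\<close>

lemma norm_diff_less_plane_reflect:
  assumes "y \<in> left_half_space k l" "z \<in> left_half_space k l"
  shows "norm (y - z) < norm (plane_reflect k l y - z)"
proof -
  have *: "(\<Sum>i\<in>UNIV. ((plane_reflect k l y - z) $ i)\<^sup>2)
    = (\<Sum>i\<in>UNIV. ((y - z) $ i)\<^sup>2) + 4 * (l - y $ k) * (l - z $ k)"
    by (simp add: sum.remove[of UNIV k] power2_eq_square algebra_simps)
  have "0 < 4 * (l - y $ k) * (l - z $ k)" using assms by (auto simp: left_half_space_def)
  with * show ?thesis
    unfolding norm_vec_def L2_set_def by (simp add: real_sqrt_less_iff)
qed

lemma riesz_kernel_plane_reflect_less:
  assumes "y \<in> left_half_space k l" "z \<in> left_half_space k l" "0 < p" "y \<noteq> z"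
  shows "riesz_kernel p (plane_reflect k l y) z < riesz_kernel p y z"
proof -
  have less: "norm (y - z) powr p < norm (plane_reflect k l y - z) powr p"
    using norm_diff_less_plane_reflect[OF assms(1,2)] assms by (intro powr_less_mono2) auto
  have "0 < norm (y - z) powr p" using assms by simp
  with less show ?thesis
    unfolding riesz_kernel_def by (intro divide_strict_left_mono mult_pos_pos) linarith+
qed

section \<open>Integrability off a small ball\<close>

text \<open>Off a ball around \<open>y\<close> the distance to \<open>y\<close> is at least a fixed
  multiple of \<open>1 + norm z\<close>, so the kernel is dominated by the weight in
  \<open>L_space\<close>.\<close>

lemma set_integrable_L_space_tail:
  assumes w: "w \<in> L_space \<alpha>" and "0 < \<alpha>" and e: "0 < e"
  defines "p \<equiv> real CARD('n) + \<alpha>"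
  shows "set_integrable lebesgue (- ball y e) (\<lambda>z. w z * riesz_kernel p (y :: real ^ 'n::finite) z)"
proof -
  have wm[measurable]: "w \<in> borel_measurable lebesgue"
    and wi: "integrable lebesgue (\<lambda>x. \<bar>w x\<bar> / (1 + norm x powr p))"
    using w by (auto simp: L_space_def p_def)
  have p: "0 < p" using assms by (simp add: p_def add_nonneg_pos)
  \<comment> \<open>Chosen so that \<open>1 + norm z \<le> B * t\<close> for
    \<open>t = norm (y - z) \<ge> e\<close>: the quotient pays for \<open>1 + norm y\<close>, the
    extra 1 for \<open>norm z \<le> norm y + t\<close>.\<close>
  define B where "B = (1 + norm y) / e + 1"
  have B: "1 \<le> B" using e by (simp add: B_def)
  have bound: "\<bar>w z\<bar> * riesz_kernel p y z \<le> (2 * B powr p) * (\<bar>w z\<bar> / (1 + norm z powr p))"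
    if z: "z \<notin> ball y e" for z
  proof -
    define t where "t = norm (y - z)"
    have t: "e \<le> t" "0 < t" using z e by (auto simp: t_def dist_norm)
    have "(1 + norm y) / e * e \<le> (1 + norm y) / e * t" using t e by (intro mult_left_mono) auto
    then have "1 + norm y \<le> (1 + norm y) / e * t" using e by simp
    moreover have "norm z \<le> norm y + t" unfolding t_def by (metis add.commute norm_minus_commute norm_triangle_sub)
    ultimately have le: "1 + norm z \<le> B * t" by (simp add: B_def algebra_simps)
    have "1 \<le> (B * t) powr p" using le p by (intro ge_one_powr_ge_zero) (auto intro: order_trans[OF _ le])
    moreover have "norm z powr p \<le> (B * t) powr p" using le p by (intro powr_mono2) auto
    ultimately have "1 + norm z powr p \<le> 2 * B powr p * t powr p"
      using B t by (simp add: powr_mult)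
    then have "1 / t powr p \<le> (2 * B powr p) / (1 + norm z powr p)"
      using t by (simp add: field_simps add_pos_nonneg)
    then have "\<bar>w z\<bar> * (1 / t powr p) \<le> \<bar>w z\<bar> * ((2 * B powr p) / (1 + norm z powr p))"
      by (intro mult_left_mono) auto
    then show ?thesis by (simp add: riesz_kernel_def t_def mult_ac)
  qed
  show ?thesis unfolding set_integrable_def
  proof (rule Bochner_Integration.integrable_bound[OF integrable_mult_right[OF wi, of "2 * B powr p"]])
    show "(\<lambda>z. indicator (- ball y e) z *\<^sub>R (w z * riesz_kernel p y z)) \<in> borel_measurable lebesgue"
      by (intro borel_measurable_scaleR borel_measurable_indicator borel_measurable_times wm
          riesz_kernel_measurable) auto
    show "AE z in lebesgue. norm (indicator (- ball y e) z *\<^sub>R (w z * riesz_kernel p y z))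
      \<le> norm (2 * B powr p * (\<bar>w z\<bar> / (1 + norm z powr p)))"
      using bound by (intro AE_I2) (auto simp: indicator_def abs_mult)
  qed
qed

text \<open>Dominated convergence with \<epsilon> written as \<open>inverse t\<close> for
  \<open>t\<close> tending to infinity; the integrands converge pointwise except possibly at
  \<open>y\<close>, a null set.\<close>

lemma tendsto_integral_off_small_ball:
  fixes f :: "'a::euclidean_space \<Rightarrow> real"
  assumes f: "integrable lebesgue f"
  shows "((\<lambda>\<epsilon>. LINT z : - ball y \<epsilon> | lebesgue. f z) \<longlongrightarrow> integral\<^sup>L lebesgue f) (at_right 0)"
  unfolding filterlim_at_right_to_top set_lebesgue_integral_def
proof (rule integral_dominated_convergence_at_top)
  show "integrable lebesgue (\<lambda>z. norm (f z))" using f by simp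
  show "f \<in> borel_measurable lebesgue" using f by simp
  show "(\<lambda>z. indicator (- ball y (inverse t)) z *\<^sub>R f z) \<in> borel_measurable lebesgue" for t
    using f by (intro borel_measurable_scaleR borel_measurable_indicator) auto
  show "\<forall>\<^sub>F t in at_top. AE z in lebesgue. norm (indicator (- ball y (inverse t)) z *\<^sub>R f z) \<le> norm (f z)"
    by (intro always_eventually allI AE_I2) (auto simp: indicator_def)
  have "AE z in lebesgue. z \<noteq> y"
    by (rule AE_I[where N = "{y}"]) auto
  then show "AE z in lebesgue. ((\<lambda>t. indicator (- ball y (inverse t)) z *\<^sub>R f z) \<longlongrightarrow> f z) at_top"
  proof eventually_elim
    case (elim z)
    then have "0 < dist y z" by auto
    then have "\<forall>\<^sub>F t in at_top. inverse t < dist y z"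
      using order_tendstoD(2)[OF tendsto_inverse_0_at_top[OF filterlim_ident]] by auto
    then have "\<forall>\<^sub>F t in at_top. indicator (- ball y (inverse t)) z *\<^sub>R f z = f z"
      by eventually_elim auto
    then show ?case by (rule tendsto_eventually)
  qed
qed

subsection \<open>Principal values\<close>

text \<open>The linear factor is odd about \<open>y\<close> and the annulus is symmetric. Removing
  the inner ball makes the integrand absolutely integrable, so the cancellation is
  legitimate.\<close>

lemma odd_kernel_annulus:
  fixes y :: "'a::euclidean_space"
  assumes "0 < \<alpha>" "0 < e"
  defines "p \<equiv> real DIM('a) + \<alpha>"
  shows "set_integrable lebesgue (ball y r - ball y e) (\<lambda>z. (g \<bullet> (z - y)) * riesz_kernel p y z)"
    and "(LINT z : ball y r - ball y e | lebesgue. (g \<bullet> (z - y)) * riesz_kernel p y z) = 0"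
proof -
  let ?A = "ball y r - ball y e"
  obtain C where C: "\<And>(y::'a) s. 0 < s \<Longrightarrow> set_integrable lebesgue (- ball y s) (riesz_kernel p y)"
    using riesz_kernel_tail_integral[OF assms(1)] unfolding p_def by blast
  have k: "integrable lebesgue (\<lambda>z. (norm g * \<bar>r\<bar>) * (indicator (- ball y e) z * riesz_kernel p y z))"
    using C[OF assms(2)] by (intro integrable_mult_right) (simp add: set_integrable_def)
  have i: "integrable lebesgue (\<lambda>z. indicator ?A z * ((g \<bullet> (z - y)) * riesz_kernel p y z))"
  proof (rule Bochner_Integration.integrable_bound[OF k])
    have m: "(\<lambda>z. g \<bullet> (z - y)) \<in> borel_measurable (lebesgue :: 'a measure)"
      by (intro measurable_completion) measurable
    show "(\<lambda>z. indicator ?A z * ((g \<bullet> (z - y)) * riesz_kernel p y z)) \<in> borel_measurable lebesgue"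
      by (intro borel_measurable_times borel_measurable_indicator m riesz_kernel_measurable) auto
    have "\<bar>g \<bullet> (z - y)\<bar> \<le> norm g * \<bar>r\<bar>" if "z \<in> ?A" for z
    proof -
      have "norm (z - y) \<le> \<bar>r\<bar>" using that by (auto simp: dist_norm norm_minus_commute)
      then show ?thesis
        using Cauchy_Schwarz_ineq2[of g "z - y"] by (meson mult_left_mono norm_ge_zero order_trans)
    qed
    then show "AE z in lebesgue. norm (indicator ?A z * ((g \<bullet> (z - y)) * riesz_kernel p y z))
        \<le> norm (norm g * \<bar>r\<bar> * (indicator (- ball y e) z * riesz_kernel p y z))"
      by (intro AE_I2) (auto simp: indicator_def abs_mult intro!: mult_right_mono)
  qed
  then show "set_integrable lebesgue ?A (\<lambda>z. (g \<bullet> (z - y)) * riesz_kernel p y z)"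
    by (simp add: set_integrable_def)
  have n: "norm (y - (2 *\<^sub>R y - z)) = norm (y - z)" for z
  proof -
    have "y - (2 *\<^sub>R y - z) = - (y - z)" by (simp add: scaleR_2)
    then show ?thesis by (metis norm_minus_cancel)
  qed
  have odd: "g \<bullet> (2 *\<^sub>R y - z - y) = - (g \<bullet> (z - y))" for z
    by (simp add: scaleR_2 inner_simps)
  have "(LINT z|lebesgue. indicator ?A z * ((g \<bullet> (z - y)) * riesz_kernel p y z)) = 0"
    by (rule integral_odd_about_point[OF i, of y])
      (simp only: indicator_def dist_norm n odd riesz_kernel_def Diff_iff mem_ball
        mult_minus_left mult_minus_right)
  then show "(LINT z : ?A | lebesgue. (g \<bullet> (z - y)) * riesz_kernel p y z) = 0"
    by (simp add: set_lebesgue_integral_def)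
qed

section \<open>Truncated integrals and existence of the principal value\<close>

definition truncated_pv :: "real \<Rightarrow> ('a::euclidean_space \<Rightarrow> real) \<Rightarrow> 'a \<Rightarrow> real \<Rightarrow> real" where
  "truncated_pv p u y e = (LINT z : - ball y e | lebesgue. (u y - u z) * riesz_kernel p y z)"

text \<open>Since \<open>Lim\<close> is total, \<open>frac_laplacian\<close> carries information
  only once convergence of the truncated integrals is known.\<close>

lemma frac_laplacian_eq_limit:
  fixes u :: "real ^ 'n::finite \<Rightarrow> real"
  assumes "(truncated_pv (real CARD('n) + \<alpha>) u x \<longlongrightarrow> L) (at_right 0)"
  shows "frac_laplacian \<alpha> u x = frac_laplacian_const CARD('n) \<alpha> * L"
proof -
  have "Lim (at_right 0) (truncated_pv (real CARD('n) + \<alpha>) u x) = L"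
    using assms by (intro tendsto_Lim) auto
  then show ?thesis
    unfolding frac_laplacian_def truncated_pv_def[abs_def] riesz_kernel_def by simp
qed

text \<open>\<open>Gamma\<close> takes the value 0 at its poles, which would make the quotient 0;
  but \<open>- \<alpha> / 2\<close> lies strictly between -1 and 0 and is no pole.\<close>

lemma frac_laplacian_const_pos:
  assumes "0 < \<alpha>" "\<alpha> < 2"
  shows "0 < frac_laplacian_const n \<alpha>"
proof -
  have "- \<alpha> / 2 \<notin> \<int>\<^sub>\<le>\<^sub>0"
  proof
    assume "- \<alpha> / 2 \<in> \<int>\<^sub>\<le>\<^sub>0"
    then obtain m :: int where m: "- \<alpha> / 2 = of_int m" by (auto elim!: nonpos_Ints_cases)
    then have "(-1::real) < of_int m" "of_int m < (0::real)" using assms by auto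
    then have "-1 < m" "m < 0" by linarith+
    then show False by simp
  qed
  then have "Gamma (- \<alpha> / 2) \<noteq> 0" by (simp add: Gamma_eq_zero_iff)
  moreover have "0 < Gamma ((real n + \<alpha>) / 2)" using assms by (intro Gamma_real_pos) auto
  ultimately show ?thesis unfolding frac_laplacian_const_def by simp
qed

text \<open>The mean value theorem on the segment from \<open>y\<close> to \<open>z\<close> gives
  the gradient at an intermediate point; the Lipschitz bound compares it with the gradient at
  \<open>y\<close>, which yields the second factor \<open>norm (y - z)\<close>.\<close>

lemma C11_loc_taylor:
  fixes w :: "'a::real_inner \<Rightarrow> real"
  assumes w: "w \<in> C11_loc \<Omega>" and "open \<Omega>" "y \<in> \<Omega>"
  obtains r g C where "0 < r" "\<And>z. z \<in> ball y r \<Longrightarrow> \<bar>w z - w y - g \<bullet> (z - y)\<bar> \<le> C * (norm (y - z))\<^sup>2"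
proof -
  obtain G where G: "\<And>x. x \<in> \<Omega> \<Longrightarrow> GDERIV w x :> G x"
    and lip: "\<And>x. x \<in> \<Omega> \<Longrightarrow> \<exists>r>0. \<exists>C. C-lipschitz_on (ball x r \<inter> \<Omega>) G"
    using w unfolding C11_loc_def by blast
  obtain r1 C where r1: "0 < r1" "C-lipschitz_on (ball y r1 \<inter> \<Omega>) G" using lip assms by blast
  obtain r2 where r2: "0 < r2" "ball y r2 \<subseteq> \<Omega>" using assms openE by blast
  show thesis
  proof (rule that[of "min r1 r2" "G y" C])
    show "0 < min r1 r2" using r1 r2 by simp
    fix z assume z: "z \<in> ball y (min r1 r2)"
    define h where "h = z - y"
    have mem: "y + t *\<^sub>R h \<in> ball y r1 \<inter> \<Omega>" if "0 \<le> t" "t \<le> 1" for t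
    proof -
      have "dist y (y + t *\<^sub>R h) = t * norm h" using that by (simp add: dist_norm)
      also have "\<dots> \<le> norm h" using that by (simp add: mult_left_le_one_le)
      also have "\<dots> < min r1 r2" using z by (simp add: h_def dist_norm norm_minus_commute)
      finally show ?thesis using r2 by auto
    qed
    have der: "DERIV (\<lambda>t. w (y + t *\<^sub>R h)) t :> h \<bullet> G (y + t *\<^sub>R h)" if "0 \<le> t" "t \<le> 1" for t
    proof -
      have "FDERIV w (y + t *\<^sub>R h) :> (\<lambda>v. v \<bullet> G (y + t *\<^sub>R h))"
        using G mem[OF that] by (auto simp: gderiv_def)
      moreover have "((\<lambda>t. y + t *\<^sub>R h) has_derivative (\<lambda>s. s *\<^sub>R h)) (at t)"
        by (auto intro!: derivative_eq_intros)
      ultimately have "((\<lambda>t. w (y + t *\<^sub>R h)) has_derivative (\<lambda>s. (s *\<^sub>R h) \<bullet> G (y + t *\<^sub>R h))) (at t)"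
        by (rule has_derivative_compose[rotated])
      then show ?thesis by (simp add: has_field_derivative_def mult_commute_abs)
    qed
    obtain t where t: "0 < t" "t < 1" "w (y + 1 *\<^sub>R h) - w (y + 0 *\<^sub>R h) = (1 - 0) * (h \<bullet> G (y + t *\<^sub>R h))"
      using MVT2[of 0 1 "\<lambda>t. w (y + t *\<^sub>R h)", OF _ der] by auto
    have "\<bar>w z - w y - G y \<bullet> (z - y)\<bar> = \<bar>h \<bullet> (G (y + t *\<^sub>R h) - G y)\<bar>"
      using t by (simp add: h_def inner_diff_right inner_commute)
    also have "\<dots> \<le> norm h * norm (G (y + t *\<^sub>R h) - G y)" by (rule Cauchy_Schwarz_ineq2)
    also have "\<dots> \<le> norm h * (C * norm h)"
    proof (rule mult_left_mono)
      have "norm (G (y + t *\<^sub>R h) - G y) \<le> C * dist (y + t *\<^sub>R h) y"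
        using lipschitz_onD[OF r1(2), of "y + t *\<^sub>R h" y] mem[of t] mem[of 0] t by (simp add: dist_norm)
      also have "\<dots> \<le> C * norm h"
        using t lipschitz_on_nonneg[OF r1(2)] by (intro mult_left_mono) (auto simp: dist_norm mult_left_le_one_le)
      finally show "norm (G (y + t *\<^sub>R h) - G y) \<le> C * norm h" .
    qed simp
    finally show "\<bar>w z - w y - G y \<bullet> (z - y)\<bar> \<le> C * (norm (y - z))\<^sup>2"
      by (simp add: h_def power2_eq_square norm_minus_commute mult_ac)
  qed
qed

lemma set_integrable_L_space_difference:
  fixes w :: "real ^ 'n::finite \<Rightarrow> real"
  assumes w: "w \<in> L_space \<alpha>" and "0 < \<alpha>" and e: "0 < e"
  shows "set_integrable lebesgue (- ball y e) (\<lambda>z. (a + b * w z) * riesz_kernel (real CARD('n) + \<alpha>) y z)"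
proof -
  have 1: "set_integrable lebesgue (- ball y e) (riesz_kernel (real CARD('n) + \<alpha>) y)"
    using riesz_kernel_tail_integral[OF assms(2), where 'a = "real ^ 'n"] e by auto
  show ?thesis
    using set_integral_add(1)[OF set_integrable_mult_right[of a, OF 1]
        set_integrable_mult_right[of b, OF set_integrable_L_space_tail[OF assms, of y]]]
    by (simp add: algebra_simps)
qed

text \<open>The linear Taylor term cancels on every annulus around \<open>y\<close>. What remains
  near \<open>y\<close> is controlled by the second moment of the kernel, hence is absolutely
  integrable.\<close>

lemma truncated_pv_convergent:
  fixes w :: "real ^ 'n::finite \<Rightarrow> real"
  assumes w: "w \<in> L_space \<alpha>" and a: "0 < \<alpha>" "\<alpha> < 2" and r: "0 < r"
    and taylor: "\<And>z. z \<in> ball y r \<Longrightarrow> \<bar>w z - w y - g \<bullet> (z - y)\<bar> \<le> C * (norm (y - z))\<^sup>2"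
  shows "\<exists>L. (truncated_pv (real CARD('n) + \<alpha>) w y \<longlongrightarrow> L) (at_right 0)"
proof -
  let ?k = "riesz_kernel (real CARD('n) + \<alpha>) y"
  have wm: "w \<in> borel_measurable lebesgue" using w by (auto simp: L_space_def)
  have out: "integrable lebesgue (\<lambda>z. indicator (- ball y r) z * ((w y - w z) * ?k z))"
    using set_integrable_L_space_difference[OF w a(1) r, of y "w y" "-1"] by (simp add: set_integrable_def)
  have mom: "integrable lebesgue (\<lambda>z. C * (indicator (ball y r) z * ((norm (y - z))\<^sup>2 * ?k z)))"
    using riesz_kernel_second_moment[OF a, where 'a = "real ^ 'n"] r
    by (intro integrable_mult_right) (auto simp: set_integrable_def)
  have inn: "integrable lebesgue (\<lambda>z. indicator (ball y r) z * ((w y - w z + g \<bullet> (z - y)) * ?k z))"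
  proof (rule Bochner_Integration.integrable_bound[OF mom])
    have m: "(\<lambda>z. g \<bullet> (z - y)) \<in> borel_measurable (lebesgue :: (real ^ 'n) measure)"
      by (intro measurable_completion) measurable
    show "(\<lambda>z. indicator (ball y r) z * ((w y - w z + g \<bullet> (z - y)) * ?k z)) \<in> borel_measurable lebesgue"
      by (intro borel_measurable_times borel_measurable_indicator borel_measurable_add
          borel_measurable_diff borel_measurable_const wm m riesz_kernel_measurable) auto
    have "\<bar>w y - w z + g \<bullet> (z - y)\<bar> \<le> \<bar>C * (norm (y - z))\<^sup>2\<bar>" if "z \<in> ball y r" for z
      using taylor[OF that] by linarith
    then show "AE z in lebesgue. norm (indicator (ball y r) z * ((w y - w z + g \<bullet> (z - y)) * ?k z))
        \<le> norm (C * (indicator (ball y r) z * ((norm (y - z))\<^sup>2 * ?k z)))"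
      by (intro AE_I2) (auto simp: indicator_def abs_mult mult.assoc[symmetric] intro!: mult_right_mono)
  qed
  \<comment> \<open>The integrand with the linear term removed inside the ball of radius
    \<open>r\<close>. Its integrals off small balls are the truncated ones, and it is integrable
    over the whole space.\<close>
  define D where "D z = indicator (ball y r) z * ((w y - w z + g \<bullet> (z - y)) * ?k z)
    + indicator (- ball y r) z * ((w y - w z) * ?k z)" for z
  have D: "integrable lebesgue D" unfolding D_def[abs_def] using inn out by (rule Bochner_Integration.integrable_add)
  have "truncated_pv (real CARD('n) + \<alpha>) w y e = (LINT z : - ball y e | lebesgue. D z)"
    if e: "0 < e" "e < r" for e
  proof -
    have odd: "integrable lebesgue (\<lambda>z. indicator (ball y r - ball y e) z * ((g \<bullet> (z - y)) * ?k z))"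
      "(LINT z | lebesgue. indicator (ball y r - ball y e) z * ((g \<bullet> (z - y)) * ?k z)) = 0"
      using odd_kernel_annulus[OF a(1) e(1), of y r g]
      by (simp_all add: set_integrable_def set_lebesgue_integral_def)
    have Di: "integrable lebesgue (\<lambda>z. indicator (- ball y e) z * D z)"
      using integrable_mult_indicator[OF _ D, of "- ball y e"] by simp
    have "truncated_pv (real CARD('n) + \<alpha>) w y e = (LINT z|lebesgue. indicator (- ball y e) z * D z
      - indicator (ball y r - ball y e) z * ((g \<bullet> (z - y)) * ?k z))"
      unfolding truncated_pv_def set_lebesgue_integral_def using e
      by (intro Bochner_Integration.integral_cong) (auto simp: D_def indicator_def algebra_simps)
    also have "\<dots> = (LINT z|lebesgue. indicator (- ball y e) z * D z)"
      using Bochner_Integration.integral_diff[OF Di odd(1)] odd(2) by simp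
    finally show ?thesis by (simp add: set_lebesgue_integral_def)
  qed
  then have "\<forall>\<^sub>F e in at_right 0. (LINT z : - ball y e | lebesgue. D z) = truncated_pv (real CARD('n) + \<alpha>) w y e"
    using r by (auto simp: eventually_at_right_field)
  then show ?thesis
    using tendsto_integral_off_small_ball[OF D, of y] by (blast intro: Lim_transform_eventually)
qed

text \<open>
  Folding loses only the part of the integral over the mirror image of the small ball, which
  vanishes in the limit.
\<close>

lemma truncated_pv_fold:
  fixes w :: "real ^ 'n::finite \<Rightarrow> real" and k :: 'n
  assumes w: "w \<in> L_space \<alpha>" and a: "0 < \<alpha>" and y: "y \<in> left_half_space k l"
    and anti: "\<And>z. z \<in> left_half_space k l \<Longrightarrow> w (plane_reflect k l z) = - w z"
  defines "p \<equiv> real CARD('n) + \<alpha>"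
  defines "F \<equiv> (\<lambda>z. (w y - w z) * riesz_kernel p y z + (w y + w z) * riesz_kernel p (plane_reflect k l y) z)"
  shows "0 < e \<Longrightarrow> set_integrable lebesgue (left_half_space k l - ball y e) F"
    and "(truncated_pv p w y \<longlongrightarrow> L) (at_right 0) \<Longrightarrow>
      ((\<lambda>e. LINT z : left_half_space k l - ball y e | lebesgue. F z) \<longlongrightarrow> L) (at_right 0)"
proof -
  let ?S = "left_half_space k l" and ?y = "plane_reflect k l y"
  define d where "d = l - y $ k"
  have d: "0 < d" using y by (simp add: d_def left_half_space_def)
  \<comment> \<open>The contribution of the far side after folding; antisymmetry turns
    \<open>w y - w (plane_reflect k l z)\<close> into \<open>w y + w z\<close>. Its kernel is
    singular only at \<open>?y\<close>, at distance at least \<open>d\<close> from the half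
    space.\<close>
  define H where "H z = indicator ?S z * ((w y + w z) * riesz_kernel p ?y z)" for z
  have sub: "?S \<subseteq> - ball ?y d"
    using dist_plane_reflect_ge[of _ k l y] by (force simp: dist_norm d_def)
  have "set_integrable lebesgue ?S (\<lambda>z. (w y + 1 * w z) * riesz_kernel p ?y z)"
    by (rule set_integrable_subset[OF set_integrable_L_space_difference[OF w a d, folded p_def] _ sub]) simp
  then have H: "integrable lebesgue H" unfolding H_def[abs_def] by (simp add: set_integrable_def)
  have He: "integrable lebesgue (\<lambda>z. indicator (- ball y e) z * H z)" for e
    using integrable_mult_indicator[OF _ H, of "- ball y e"] by simp
  have near: "set_integrable lebesgue (- ball y e) (\<lambda>z. (w y - w z) * riesz_kernel p y z)" if "0 < e" for e
    using set_integrable_L_space_difference[OF w a that, of y "w y" "-1"] by (simp add: p_def)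
  have inn: "integrable lebesgue (\<lambda>z. indicator (?S - ball y e) z * ((w y - w z) * riesz_kernel p y z))"
    if "0 < e" for e
  proof -
    have "set_integrable lebesgue (?S - ball y e) (\<lambda>z. (w y - w z) * riesz_kernel p y z)"
      by (rule set_integrable_subset[OF near[OF that]]) (auto intro: sets.Diff sets_lebesgue_left_half_space)
    then show ?thesis by (simp add: set_integrable_def)
  qed
  have F_eq: "indicator (?S - ball y e) z * F z = indicator (?S - ball y e) z * ((w y - w z) * riesz_kernel p y z)
    + indicator (- ball y e) z * H z" for e z
    by (auto simp: F_def H_def indicator_def)
  have "integrable lebesgue (\<lambda>z. indicator (?S - ball y e) z * F z)" if "0 < e" for e
    unfolding F_eq using inn[OF that] He by (rule Bochner_Integration.integrable_add)
  then show "set_integrable lebesgue (?S - ball y e) F" if "0 < e"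
    using that by (simp add: set_integrable_def)
  assume L: "(truncated_pv p w y \<longlongrightarrow> L) (at_right 0)"
  have eq: "(LINT z : ?S - ball y e | lebesgue. F z)
      = truncated_pv p w y e - integral\<^sup>L lebesgue H + (LINT z : - ball y e | lebesgue. H z)"
    if e: "0 < e" "e < d" for e
  proof -
    define T where "T z = indicator (- ball y e) z * ((w y - w z) * riesz_kernel p y z)" for z
    have T: "integrable lebesgue T" unfolding T_def[abs_def] using near[OF e(1)] by (simp add: set_integrable_def)
    \<comment> \<open>As \<open>e < d\<close>, mirror images of points of the half space stay
      outside the removed ball, so no cutoff survives.\<close>
    have refl: "indicator ?S z * T (plane_reflect k l z) = H z" for z
    proof (cases "z \<in> ?S")
      case True
      then have "e \<le> dist y (plane_reflect k l z)"
        using dist_plane_reflect_ge[OF True, of y] e by (simp add: dist_norm norm_plane_reflect_diff d_def)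
      then show ?thesis using anti[OF True] by (simp add: T_def H_def riesz_kernel_plane_reflect)
    qed (simp add: H_def)
    have "truncated_pv p w y e = integral\<^sup>L lebesgue T"
      by (simp add: truncated_pv_def set_lebesgue_integral_def T_def[abs_def])
    also have "\<dots> = (LINT z|lebesgue. indicator ?S z * T z) + integral\<^sup>L lebesgue H"
      using integral_fold_left_half_space[OF T, of k l] by (simp add: set_lebesgue_integral_def refl)
    also have "(LINT z|lebesgue. indicator ?S z * T z)
      = (LINT z|lebesgue. indicator (?S - ball y e) z * ((w y - w z) * riesz_kernel p y z))"
      by (intro Bochner_Integration.integral_cong) (auto simp: T_def indicator_def)
    also have "\<dots> = (LINT z : ?S - ball y e | lebesgue. F z) - (LINT z : - ball y e | lebesgue. H z)"
      unfolding set_lebesgue_integral_def real_scaleR_def F_eq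
      by (subst Bochner_Integration.integral_add[OF inn[OF e(1)] He]) simp
    finally show ?thesis by simp
  qed
  have "((\<lambda>e. truncated_pv p w y e - integral\<^sup>L lebesgue H + (LINT z : - ball y e | lebesgue. H z))
    \<longlongrightarrow> L - integral\<^sup>L lebesgue H + integral\<^sup>L lebesgue H) (at_right 0)"
    by (intro tendsto_intros L tendsto_integral_off_small_ball H)
  then have "((\<lambda>e. truncated_pv p w y e - integral\<^sup>L lebesgue H + (LINT z : - ball y e | lebesgue. H z))
    \<longlongrightarrow> L) (at_right 0)" by simp
  moreover have "\<forall>\<^sub>F e in at_right 0. truncated_pv p w y e - integral\<^sup>L lebesgue H + (LINT z : - ball y e | lebesgue. H z)
    = (LINT z : ?S - ball y e | lebesgue. F z)"
    using d eq by (auto simp: eventually_at_right_field)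
  ultimately show "((\<lambda>e. LINT z : ?S - ball y e | lebesgue. F z) \<longlongrightarrow> L) (at_right 0)"
    by (rule Lim_transform_eventually)
qed

section \<open>Estimates for the folded principal value\<close>

lemma norm_axis_real: "norm (axis k c :: real ^ 'n::finite) = \<bar>c\<bar>"
proof -
  have "axis k c = c *\<^sub>R (axis k 1 :: real ^ 'n)" by (auto simp: vec_eq_iff axis_def)
  then show ?thesis by simp
qed

text \<open>With \<open>d\<close> the distance to the hyperplane, some ball of radius
  \<open>d\<close> lies in the half space, misses the removed ball and stays within
  \<open>5 * d\<close> of the mirror image; the kernel is at least \<open>(5 * d) powr - p\<close>
  on it.\<close>

lemma riesz_kernel_reflected_mass:
  fixes y :: "real ^ 'n::finite" and k :: 'n
  assumes "0 < \<alpha>" and y: "y \<in> left_half_space k l" and e: "0 < e" "e \<le> l - y $ k"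
  defines "p \<equiv> real CARD('n) + \<alpha>"
  shows "set_integrable lebesgue (left_half_space k l - ball y e) (riesz_kernel p (plane_reflect k l y))"
    and "unit_ball_vol CARD('n) * 5 powr - p * (l - y $ k) powr - \<alpha>
      \<le> (LINT z : left_half_space k l - ball y e | lebesgue. riesz_kernel p (plane_reflect k l y) z)"
proof -
  let ?S = "left_half_space k l" and ?y = "plane_reflect k l y"
  define d where "d = l - y $ k"
  have d: "0 < d" "e \<le> d" using y e by (auto simp: d_def left_half_space_def)
  have sub: "?S - ball y e \<subseteq> - ball ?y d"
    using dist_plane_reflect_ge[of _ k l y] by (force simp: dist_norm d_def)
  have tail: "set_integrable lebesgue (- ball ?y d) (riesz_kernel p ?y)"
    using riesz_kernel_tail_integral[OF assms(1), where 'a = "real ^ 'n"] d(1) by (auto simp: p_def)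
  have Ssets: "?S - ball y e \<in> sets lebesgue"
    by (intro sets.Diff sets_lebesgue_left_half_space) auto
  show int: "set_integrable lebesgue (?S - ball y e) (riesz_kernel p ?y)"
    by (rule set_integrable_subset[OF tail Ssets sub])
  \<comment> \<open>Centre at distance \<open>3 * d\<close> from the hyperplane,
    \<open>2 * d\<close> from \<open>y\<close> and \<open>4 * d\<close> from the mirror image of
    \<open>y\<close>.\<close>
  define x where "x = y - axis k (2 * d)"
  have yx: "?y - x = axis k (4 * d)" by (auto simp: vec_eq_iff x_def axis_def d_def)
  have ball: "z \<in> ?S - ball y e \<and> norm (?y - z) \<le> 5 * d" if z: "z \<in> ball x d" for z
  proof -
    have xz: "norm (x - z) < d" using z by (simp add: dist_norm)
    have "\<bar>(x - z) $ k\<bar> < d" using component_le_norm_cart[of "x - z" k] xz by simp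
    then have "z $ k < l" using d by (simp add: x_def d_def)
    moreover have "2 * d = norm (y - x)" using d by (simp add: x_def norm_axis_real)
    then have "d < norm (y - z)" using xz norm_triangle_ineq[of "y - z" "z - x"] by (simp add: norm_minus_commute)
    moreover have "norm (?y - z) \<le> norm (?y - x) + norm (x - z)"
      using norm_triangle_ineq[of "?y - x" "x - z"] by simp
    then have "norm (?y - z) \<le> 5 * d" using xz d by (simp add: yx norm_axis_real)
    ultimately show ?thesis using d by (simp add: left_half_space_def dist_norm)
  qed
  have "unit_ball_vol CARD('n) * 5 powr - p * d powr - \<alpha> = (5 * d) powr - p * measure lebesgue (ball x d)"
  proof -
    have "measure lebesgue (ball x d) = unit_ball_vol CARD('n) * d powr CARD('n)"
      using d content_ball[of d x] by (simp add: powr_realpow)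
    moreover have "d powr - p * d powr CARD('n) = d powr - \<alpha>" by (simp add: powr_add[symmetric] p_def)
    ultimately show ?thesis using d by (simp add: powr_mult mult_ac)
  qed
  also have "\<dots> = (LINT z|lebesgue. (5 * d) powr - p * indicator (ball x d) z)"
    by simp
  also have "\<dots> \<le> (LINT z|lebesgue. indicator (?S - ball y e) z * riesz_kernel p ?y z)"
  proof (rule integral_mono)
    show "integrable lebesgue (\<lambda>z. (5 * d) powr - p * indicator (ball x d) z)"
      using d by (intro integrable_mult_right integrable_real_indicator) (auto simp: emeasure_ball)
    show "integrable lebesgue (\<lambda>z. indicator (?S - ball y e) z * riesz_kernel p ?y z)"
      using int by (simp add: set_integrable_def)
    fix z
    show "(5 * d) powr - p * indicator (ball x d) z \<le> indicator (?S - ball y e) z * riesz_kernel p ?y z"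
    proof (cases "z \<in> ball x d")
      case True
      have "0 < norm (?y - z)"
        using dist_plane_reflect_ge[of z k l y] ball[OF True] d by (auto simp: d_def)
      then have "(5 * d) powr - p \<le> riesz_kernel p ?y z"
        unfolding riesz_kernel_def powr_minus_divide
        using ball[OF True] d assms(1) by (intro divide_left_mono powr_mono2) (auto simp: p_def)
      then show ?thesis using ball[OF True] True by simp
    qed simp
  qed
  finally show "unit_ball_vol CARD('n) * 5 powr - p * (l - y $ k) powr - \<alpha>
      \<le> (LINT z : ?S - ball y e | lebesgue. riesz_kernel p ?y z)"
    by (simp add: set_lebesgue_integral_def d_def)
qed

text \<open>The linear part of the paraboloid integrates to 0; its quadratic part and the tail give
  \<open>\<kappa> * B\<close> and \<open>A\<close>. Half of \<open>2 * w y\<close> times the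
  reflected kernel is kept as the main term; the other half absorbs the reflected kernel's share of
  the error, by the two bounds with constant 3.\<close>

lemma truncated_pv_upper_bound:
  fixes w :: "real ^ 'n::finite \<Rightarrow> real" and k :: 'n
  assumes w: "w \<in> L_space \<alpha>" and a: "0 < \<alpha>" and y: "y \<in> left_half_space k l"
    and anti: "\<And>z. z \<in> left_half_space k l \<Longrightarrow> w (plane_reflect k l z) = - w z"
    and s: "0 < s" "s \<le> l - y $ k" and \<epsilon>: "0 \<le> \<epsilon>" "3 * \<epsilon> \<le> - w y"
    and \<kappa>: "0 \<le> \<kappa>"
    and near: "\<And>z. z \<in> left_half_space k l \<Longrightarrow> z \<in> ball y s \<Longrightarrow>
      w y - w z \<le> \<epsilon> * (g \<bullet> (z - y) + \<kappa> * (norm (y - z))\<^sup>2)"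
    and small: "\<And>z. z \<in> ball y s \<Longrightarrow> - 3 \<le> g \<bullet> (z - y) + \<kappa> * (norm (y - z))\<^sup>2"
    and far: "\<And>z. z \<in> left_half_space k l \<Longrightarrow> w y - w z \<le> \<epsilon>"
  defines "p \<equiv> real CARD('n) + \<alpha>"
  assumes L: "(truncated_pv p w y \<longlongrightarrow> L) (at_right 0)"
    and tail: "set_integrable lebesgue (- ball y s) (riesz_kernel p y)"
      "(LINT z : - ball y s | lebesgue. riesz_kernel p y z) \<le> A"
    and mom: "set_integrable lebesgue (ball y s) (\<lambda>z. (norm (y - z))\<^sup>2 * riesz_kernel p y z)"
      "(LINT z : ball y s | lebesgue. (norm (y - z))\<^sup>2 * riesz_kernel p y z) \<le> B"
  shows "L \<le> \<epsilon> * (A + \<kappa> * B)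
    + w y * (unit_ball_vol CARD('n) * 5 powr - p * (l - y $ k) powr - \<alpha>)"
proof -
  let ?S = "left_half_space k l" and ?y = "plane_reflect k l y"
  define F where "F z = (w y - w z) * riesz_kernel p y z + (w y + w z) * riesz_kernel p ?y z" for z
  define M where "M = unit_ball_vol CARD('n) * 5 powr - p * (l - y $ k) powr - \<alpha>"
  have p: "0 < p" using a by (simp add: p_def add_nonneg_pos)
  have bound: "(LINT z : ?S - ball y e | lebesgue. F z) \<le> \<epsilon> * (A + \<kappa> * B) + w y * M" if e: "0 < e" "e < s" for e
  proof -
    let ?f1 = "\<lambda>z. indicator (- ball y s) z * riesz_kernel p y z"
    let ?f2 = "\<lambda>z. indicator (ball y s) z * ((norm (y - z))\<^sup>2 * riesz_kernel p y z)"
    let ?f3 = "\<lambda>z. indicator (ball y s - ball y e) z * ((g \<bullet> (z - y)) * riesz_kernel p y z)"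
    let ?f4 = "\<lambda>z. indicator (?S - ball y e) z * riesz_kernel p ?y z"
    have f1: "integrable lebesgue ?f1" "integral\<^sup>L lebesgue ?f1 \<le> A"
      using tail by (simp_all add: set_integrable_def set_lebesgue_integral_def)
    have f2: "integrable lebesgue ?f2" "integral\<^sup>L lebesgue ?f2 \<le> B"
      using mom by (simp_all add: set_integrable_def set_lebesgue_integral_def)
    have f3: "integrable lebesgue ?f3" "integral\<^sup>L lebesgue ?f3 = 0"
      using odd_kernel_annulus[OF a e(1), of y s g] by (simp_all add: set_integrable_def set_lebesgue_integral_def p_def)
    have f4: "integrable lebesgue ?f4" "M \<le> integral\<^sup>L lebesgue ?f4"
      using riesz_kernel_reflected_mass[OF a y e(1)] e s
      by (simp_all add: set_integrable_def set_lebesgue_integral_def p_def M_def)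
    have "(LINT z : ?S - ball y e | lebesgue. F z) = (LINT z | lebesgue. indicator (?S - ball y e) z * F z)"
      by (simp add: set_lebesgue_integral_def)
    also have "\<dots> \<le> (LINT z | lebesgue. \<epsilon> * (?f1 z + \<kappa> * ?f2 z + ?f3 z) + w y * ?f4 z)"
    proof (rule integral_mono)
      show "integrable lebesgue (\<lambda>z. indicator (?S - ball y e) z * F z)"
        using truncated_pv_fold(1)[OF w a y anti e(1)] by (simp add: set_integrable_def F_def[abs_def] p_def)
      show "integrable lebesgue (\<lambda>z. \<epsilon> * (?f1 z + \<kappa> * ?f2 z + ?f3 z) + w y * ?f4 z)"
        by (intro Bochner_Integration.integrable_add integrable_mult_right f1 f2 f3 f4)
      fix z
      show "indicator (?S - ball y e) z * F z \<le> \<epsilon> * (?f1 z + \<kappa> * ?f2 z + ?f3 z) + w y * ?f4 z"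
      proof (cases "z \<in> ?S - ball y e")
        case False
        \<comment> \<open>The majorant extends beyond the half space, where it must be nonnegative.
          Only \<open>?f3\<close> can be negative, and its annulus lies inside the half space since
          \<open>s \<le> l - y $ k\<close>.\<close>
        have "0 \<le> ?f1 z + \<kappa> * ?f2 z + ?f3 z"
        proof (cases "z \<in> ball y s - ball y e")
          case True
          then have "z \<in> ball y (l - y $ k)" using s by auto
          then have "\<bar>(z - y) $ k\<bar> < l - y $ k"
            using component_le_norm_cart[of "z - y" k] by (simp add: dist_norm norm_minus_commute)
          then have "z \<in> ?S" by (simp add: left_half_space_def)
          with True False show ?thesis by simp
        qed (use \<kappa> in auto)
        then show ?thesis using False \<epsilon> by simp
      next
        case True
        then have z: "z \<in> ?S" "z \<notin> ball y e" "y \<noteq> z" using e by auto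
        define m where "m = (if z \<in> ball y s then g \<bullet> (z - y) + \<kappa> * (norm (y - z))\<^sup>2 else 1)"
        have m: "w y - w z \<le> \<epsilon> * m" "- 3 \<le> m"
          using near[OF z(1)] far[OF z(1)] small[of z] by (auto simp: m_def)
        have k: "0 \<le> riesz_kernel p y z - riesz_kernel p ?y z"
          using riesz_kernel_plane_reflect_less[OF y z(1) p z(3)] by simp
        have "\<epsilon> * (- 3) \<le> \<epsilon> * m" using m(2) \<epsilon>(1) by (rule mult_left_mono)
        \<comment> \<open>From
          \<open>- \<epsilon> * m \<le> 3 * \<epsilon> \<le> - w y\<close>.\<close>
        then have c: "2 * w y - \<epsilon> * m \<le> w y" using \<epsilon> by linarith
        have "F z = (w y - w z) * (riesz_kernel p y z - riesz_kernel p ?y z) + 2 * w y * riesz_kernel p ?y z"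
          by (simp add: F_def algebra_simps)
        also have "\<dots> \<le> \<epsilon> * m * (riesz_kernel p y z - riesz_kernel p ?y z) + 2 * w y * riesz_kernel p ?y z"
          using m(1) k by (simp add: mult_right_mono)
        also have "\<dots> = \<epsilon> * m * riesz_kernel p y z + (2 * w y - \<epsilon> * m) * riesz_kernel p ?y z"
          by (simp add: algebra_simps)
        also have "\<dots> \<le> \<epsilon> * m * riesz_kernel p y z + w y * riesz_kernel p ?y z"
          using mult_right_mono[OF c, of "riesz_kernel p ?y z"] by simp
        also have "m * riesz_kernel p y z = ?f1 z + \<kappa> * ?f2 z + ?f3 z"
          using z by (auto simp: m_def algebra_simps)
        then have "\<epsilon> * m * riesz_kernel p y z = \<epsilon> * (?f1 z + \<kappa> * ?f2 z + ?f3 z)"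
          by (metis mult.assoc)
        finally show ?thesis using True by simp
      qed
    qed
    also have "\<dots> = \<epsilon> * (integral\<^sup>L lebesgue ?f1 + \<kappa> * integral\<^sup>L lebesgue ?f2) + w y * integral\<^sup>L lebesgue ?f4"
      using f1(1) f2(1) f3 f4(1)
      by (simp only: Bochner_Integration.integral_add Bochner_Integration.integrable_add integrable_mult_right
          integral_mult_right_zero add_0_right)
    also have "\<dots> \<le> \<epsilon> * (A + \<kappa> * B) + w y * M"
      using f1 f2 f4 \<epsilon> \<kappa> by (intro add_mono mult_left_mono mult_left_mono_neg) auto
    finally show ?thesis .
  qed
  have "((\<lambda>e. LINT z : ?S - ball y e | lebesgue. F z) \<longlongrightarrow> L) (at_right 0)"
    using truncated_pv_fold(2)[OF w a y anti] L by (simp add: F_def[abs_def] p_def)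
  moreover have "\<forall>\<^sub>F e in at_right 0. (LINT z : ?S - ball y e | lebesgue. F z) \<le> \<epsilon> * (A + \<kappa> * B) + w y * M"
    using s bound by (auto simp: eventually_at_right_field)
  ultimately show ?thesis unfolding M_def by (rule tendsto_upperbound) simp
qed

text \<open>The folded integrand is nonpositive, so shrinking the removed ball only lowers the
  integral. A nonnegative limit thus forces every one of these integrals to vanish.\<close>

lemma antisymmetric_eq_0_of_truncated_pv:
  fixes w :: "real ^ 'n::finite \<Rightarrow> real" and k :: 'n
  assumes w: "w \<in> L_space \<alpha>" and a: "0 < \<alpha>" and y: "y \<in> left_half_space k l"
    and anti: "\<And>z. z \<in> left_half_space k l \<Longrightarrow> w (plane_reflect k l z) = - w z"
    and nonneg: "\<And>z. z \<in> left_half_space k l \<Longrightarrow> 0 \<le> w z" and "w y = 0"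
    and L: "(truncated_pv (real CARD('n) + \<alpha>) w y \<longlongrightarrow> L) (at_right 0)" "0 \<le> L"
  shows "AE x in lebesgue. w x = 0"
proof -
  let ?S = "left_half_space k l" and ?y = "plane_reflect k l y"
  define p where "p = real CARD('n) + \<alpha>"
  have p: "0 < p" using a by (simp add: p_def add_nonneg_pos)
  define F where "F z = (w y - w z) * riesz_kernel p y z + (w y + w z) * riesz_kernel p ?y z" for z
  have F: "F z = - (w z * (riesz_kernel p y z - riesz_kernel p ?y z))" for z
    using \<open>w y = 0\<close> by (simp add: F_def algebra_simps)
  have pos: "0 < riesz_kernel p y z - riesz_kernel p ?y z" if "z \<in> ?S" "z \<noteq> y" for z
    using riesz_kernel_plane_reflect_less[OF y that(1) p] that by auto
  have int: "integrable lebesgue (\<lambda>z. indicator (?S - ball y e) z * F z)" if "0 < e" for e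
    using truncated_pv_fold(1)[OF w a y anti that] by (simp add: set_integrable_def F_def[abs_def] p_def)
  have lim: "((\<lambda>e. LINT z : ?S - ball y e | lebesgue. F z) \<longlongrightarrow> L) (at_right 0)"
    using truncated_pv_fold(2)[OF w a y anti L(1)] by (simp add: F_def[abs_def] p_def)
  have nonpos: "indicator (?S - ball y e) z * F z \<le> 0" if "0 < e" for e z
  proof (cases "z \<in> ?S - ball y e")
    case True
    then have z: "z \<in> ?S" "z \<noteq> y" using that by auto
    have "0 \<le> w z * (riesz_kernel p y z - riesz_kernel p ?y z)"
      by (rule mult_nonneg_nonneg[OF nonneg[OF z(1)] less_imp_le[OF pos[OF z]]])
    then show ?thesis using True by (simp add: F)
  qed simp
  have zero: "AE z in lebesgue. indicator (?S - ball y r) z * F z = 0" if r: "0 < r" for r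
  proof -
    have "(LINT z : ?S - ball y e | lebesgue. F z) \<le> (LINT z : ?S - ball y r | lebesgue. F z)"
      if e: "0 < e" "e < r" for e
      unfolding set_lebesgue_integral_def real_scaleR_def
    proof (rule integral_mono[OF int[OF e(1)] int[OF r]])
      show "indicator (?S - ball y e) z * F z \<le> indicator (?S - ball y r) z * F z" for z
        using nonpos[OF e(1), of z] e by (auto simp: indicator_def)
    qed
    then have "L \<le> (LINT z : ?S - ball y r | lebesgue. F z)"
      using r by (intro tendsto_upperbound[OF lim]) (auto simp: eventually_at_right_field)
    then have "0 \<le> (LINT z | lebesgue. indicator (?S - ball y r) z * F z)"
      using L(2) by (simp add: set_lebesgue_integral_def)
    moreover have "(LINT z | lebesgue. indicator (?S - ball y r) z * F z) \<le> 0"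
      using Bochner_Integration.integral_nonneg[of lebesgue "\<lambda>z. - (indicator (?S - ball y r) z * F z)"] nonpos[OF r]
      by simp
    ultimately have "(LINT z | lebesgue. - (indicator (?S - ball y r) z * F z)) = 0" by simp
    then show ?thesis
      using integral_nonneg_eq_0_iff_AE[of lebesgue "\<lambda>z. - (indicator (?S - ball y r) z * F z)"] int[OF r] nonpos[OF r]
      by (simp del: integral_minus)
  qed
  \<comment> \<open>Countably many radii suffice to reach every point other than
    \<open>y\<close>.\<close>
  have "AE z in lebesgue. \<forall>n. indicator (?S - ball y (inverse (Suc n))) z * F z = 0"
    unfolding AE_all_countable using zero by simp
  moreover have "AE z in lebesgue. z \<noteq> y" by (rule AE_I[where N = "{y}"]) auto
  ultimately have half: "AE z in lebesgue. z \<in> ?S \<longrightarrow> w z = 0"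
  proof eventually_elim
    case (elim z)
    show ?case
    proof
      assume z: "z \<in> ?S"
      obtain n where "inverse (Suc n) < dist y z" using elim(2) reals_Archimedean[of "dist y z"] by auto
      then have "F z = 0" using elim(1)[rule_format, of n] z by simp
      then show "w z = 0" using pos[OF z elim(2)] by (simp add: F)
    qed
  qed
  \<comment> \<open>Transfers the null set to the other side of the hyperplane, as the reflection
    preserves the measure.\<close>
  then have "AE z in distr lebesgue lebesgue (plane_reflect k l). z \<in> ?S \<longrightarrow> w z = 0"
    by (simp only: lebesgue_plane_reflect)
  then have "AE z in lebesgue. plane_reflect k l z \<in> ?S \<longrightarrow> w (plane_reflect k l z) = 0"
    by (rule AE_distrD[OF lebesgue_plane_reflect(1)])
  with half AE_not_on_plane[of k l] show ?thesis
  proof eventually_elim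
    case (elim z)
    show ?case
    proof (cases "z \<in> ?S")
      case False
      then have "plane_reflect k l z \<in> ?S" using elim by (simp add: left_half_space_def)
      then show ?thesis using elim anti[of "plane_reflect k l z"] by simp
    qed (use elim in auto)
  qed
qed

subsection \<open>Lower semicontinuity and touching points\<close>

lemma lower_semicontinuous_on_subset:
  "lower_semicontinuous_on S f \<Longrightarrow> T \<subseteq> S \<Longrightarrow> lower_semicontinuous_on T f"
  unfolding lower_semicontinuous_on_def by (meson at_le filter_leD subsetD)

lemma lower_semicontinuous_on_add_continuous:
  fixes f g :: "'a::topological_space \<Rightarrow> real"
  assumes f: "lower_semicontinuous_on S f" and g: "continuous_on S g"
  shows "lower_semicontinuous_on S (\<lambda>x. f x + g x)"
  unfolding lower_semicontinuous_on_def
proof (intro ballI allI impI)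
  fix x a assume x: "x \<in> S" and a: "a < f x + g x"
  define e where "e = (f x + g x - a) / 2"
  have e: "0 < e" using a by (simp add: e_def)
  have "\<forall>\<^sub>F y in at x within S. f x - e < f y"
    using f x e unfolding lower_semicontinuous_on_def by simp
  moreover have "\<forall>\<^sub>F y in at x within S. g x - e < g y"
    using g x e by (intro order_tendstoD(1)) (auto simp: continuous_on_def)
  ultimately show "\<forall>\<^sub>F y in at x within S. a < f y + g y"
    by eventually_elim (simp add: e_def field_simps)
qed

text \<open>If no minimum existed, every \<open>x\<close> would have a point \<open>h x\<close> with
  a smaller value, and the neighbourhoods on which \<open>f\<close> exceeds \<open>f (h x)\<close>
  would cover \<open>S\<close>. In a finite subcover, the smallest \<open>f (h x)\<close> is
  undercut by the neighbourhood containing that \<open>h x\<close>.\<close>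

lemma lower_semicontinuous_on_attains_inf:
  fixes f :: "'a::topological_space \<Rightarrow> real"
  assumes S: "compact S" "S \<noteq> {}" and f: "lower_semicontinuous_on S f"
  shows "\<exists>x\<in>S. \<forall>y\<in>S. f x \<le> f y"
proof (rule ccontr)
  assume "\<not> ?thesis"
  then have "\<forall>x\<in>S. \<exists>y\<in>S. f y < f x" by force
  then obtain h where h: "\<And>x. x \<in> S \<Longrightarrow> h x \<in> S \<and> f (h x) < f x" by metis
  have "\<forall>x\<in>S. \<exists>U. open U \<and> x \<in> U \<and> (\<forall>y\<in>U \<inter> S. f (h x) < f y)"
  proof
    fix x assume x: "x \<in> S"
    then have "\<forall>\<^sub>F y in at x within S. f (h x) < f y"
      using f h unfolding lower_semicontinuous_on_def by blast
    then obtain U where "open U" "x \<in> U" "\<And>y. y \<in> U \<Longrightarrow> y \<noteq> x \<Longrightarrow> y \<in> S \<Longrightarrow> f (h x) < f y"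
      unfolding eventually_at_topological by blast
    then show "\<exists>U. open U \<and> x \<in> U \<and> (\<forall>y\<in>U \<inter> S. f (h x) < f y)" using h[OF x] by (metis IntD1 IntD2)
  qed
  then obtain U where U: "\<And>x. x \<in> S \<Longrightarrow> open (U x) \<and> x \<in> U x \<and> (\<forall>y\<in>U x \<inter> S. f (h x) < f y)" by metis
  obtain T where T: "T \<subseteq> S" "finite T" "S \<subseteq> (\<Union>x\<in>T. U x)"
    using compactE_image[OF S(1), of S U] U by blast
  have "T \<noteq> {}" using T S(2) by auto
  then obtain x where x: "x \<in> T" "\<And>z. z \<in> T \<Longrightarrow> f (h x) \<le> f (h z)"
    using arg_min_if_finite[OF T(2), of "\<lambda>x. f (h x)"] by (metis not_less)
  have "h x \<in> S" using h x T by blast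
  then obtain z where z: "z \<in> T" "h x \<in> U z" using T by blast
  have "f (h z) < f (h x)" using U[of z] z T \<open>h x \<in> S\<close> by blast
  with x(2)[OF z(1)] show False by simp
qed

text \<open>Far away, either \<open>\<Omega>\<close> has no points or the lower limit gives the
  bound -1; the rest of the closure is compact and a minimum is attained there.\<close>

lemma lower_semicontinuous_on_closure_bdd_below:
  fixes w :: "'a::euclidean_space \<Rightarrow> real"
  assumes lsc: "lower_semicontinuous_on (closure \<Omega>) w"
    and bd: "bounded \<Omega> \<or> Liminf at_infinity (\<lambda>x. ereal (w x)) \<ge> 0"
  shows "bdd_below (w ` \<Omega>)"
proof -
  obtain R where R: "\<And>x. x \<in> \<Omega> \<Longrightarrow> R \<le> norm x \<Longrightarrow> -1 \<le> w x"
  proof (cases "bounded \<Omega>")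
    case True
    then obtain B where "\<And>x. x \<in> \<Omega> \<Longrightarrow> norm x \<le> B" unfolding bounded_iff by blast
    then show ?thesis by (intro that[of "B + 1"]) force
  next
    case False
    have "ereal (-1) < 0" by simp
    also have "0 \<le> Liminf at_infinity (\<lambda>x. ereal (w x))" using False bd by simp
    finally have "ereal (-1) < Liminf at_infinity (\<lambda>x. ereal (w x))" .
    then have "\<forall>\<^sub>F x in at_infinity. ereal (-1) < ereal (w x)" by (rule less_LiminfD)
    then obtain B where "\<And>x. B \<le> norm x \<Longrightarrow> -1 < w x"
      unfolding eventually_at_infinity by auto
    then show ?thesis by (intro that[of B]) force
  qed
  have comp: "compact (closure \<Omega> \<inter> cball 0 R)" by (simp add: closed_Int_compact)
  have "\<exists>b. \<forall>x\<in>closure \<Omega> \<inter> cball 0 R. b \<le> w x"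
  proof (cases "closure \<Omega> \<inter> cball 0 R = {}")
    case False
    then show ?thesis
      using lower_semicontinuous_on_attains_inf[OF comp False lower_semicontinuous_on_subset[OF lsc]] by blast
  qed auto
  then obtain b where b: "\<And>x. x \<in> closure \<Omega> \<inter> cball 0 R \<Longrightarrow> b \<le> w x" by blast
  have "min b (-1) \<le> w x" if "x \<in> \<Omega>" for x
    using R[OF that] b[of x] that closure_subset[of \<Omega>] by (cases "R \<le> norm x") (auto simp: min_le_iff_disj)
  then show ?thesis by (intro bdd_belowI[of _ "min b (-1)"]) auto
qed

text \<open>
  The infimum of a negative \<open>w\<close> may be approached only at the boundary hyperplane, where \<open>w\<close>
  is subject to no sign condition. Adding a small paraboloid supported on a ball whose radius is comparable with
  the distance to the hyperplane produces an interior touching point instead.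
\<close>

lemma touching_point:
  fixes w :: "real ^ 'n::finite \<Rightarrow> real"
  assumes sub: "\<Omega> \<subseteq> left_half_space k l"
    and lsc: "lower_semicontinuous_on (closure \<Omega>) w" and bdd: "bdd_below (w ` \<Omega>)"
    and nonneg: "\<And>x. x \<in> left_half_space k l - \<Omega> \<Longrightarrow> 0 \<le> w x"
    and neg: "x\<^sub>1 \<in> \<Omega>" "w x\<^sub>1 < 0" and \<theta>: "0 < \<theta>" "\<theta> \<le> 1 / 8"
  obtains y r \<epsilon> g where "y \<in> \<Omega>" "0 < r" "3 * r \<le> l - y $ k" "l - y $ k \<le> 5 * r" "w y < 0"
    "0 < \<epsilon>" "\<epsilon> \<le> - (2 * \<theta> * w y)" "3 * \<epsilon> \<le> - w y"
    "\<And>z. z \<in> left_half_space k l \<Longrightarrow> w y - w z \<le> \<epsilon> * (g \<bullet> (z - y) + (1 / r\<^sup>2) * (norm (y - z))\<^sup>2)"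
    "\<And>z. z \<in> ball y r \<Longrightarrow> - 3 \<le> g \<bullet> (z - y) + (1 / r\<^sup>2) * (norm (y - z))\<^sup>2"
    "\<And>z. z \<in> left_half_space k l \<Longrightarrow> w y - w z \<le> \<epsilon>"
proof -
  let ?S = "left_half_space k l"
  define m where "m = Inf (w ` \<Omega>)"
  have m_le: "m \<le> w x" if "x \<in> \<Omega>" for x
    unfolding m_def using bdd that by (intro cInf_lower) auto
  have m: "m < 0" using m_le[OF neg(1)] neg(2) by simp
  have m_le': "m \<le> w x" if "x \<in> ?S" for x
    using m_le[of x] nonneg[of x] that m by (cases "x \<in> \<Omega>") force+
  \<comment> \<open>The height of the paraboloid is a fixed small fraction of the depth
    \<open>- m\<close> of the infimum.\<close>
  define \<epsilon> where "\<epsilon> = \<theta> * (- m)"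
  have \<epsilon>: "0 < \<epsilon>" "\<epsilon> \<le> - m / 8" using \<theta> m mult_right_mono[of \<theta> "1/8" "- m"] by (auto simp: \<epsilon>_def mult_pos_neg)
  obtain x where x: "x \<in> \<Omega>" "w x < m + \<epsilon>"
    using cInf_lessD[of "w ` \<Omega>" "m + \<epsilon>"] \<epsilon> neg by (auto simp: m_def)
  \<comment> \<open>A quarter of the distance to the hyperplane: points of the ball of radius
    \<open>r\<close> around \<open>x\<close> stay at distance between \<open>3 * r\<close> and
    \<open>5 * r\<close> from it.\<close>
  define r where "r = (l - x $ k) / 4"
  have xS: "x \<in> ?S" using x sub by auto
  then have r: "0 < r" by (simp add: r_def left_half_space_def)
  \<comment> \<open>Paraboloid with value 1 at \<open>x\<close>, 0 on the sphere of radius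
    \<open>r\<close> and negative values beyond it.\<close>
  define q where "q z = 1 - (norm (z - x))\<^sup>2 / r\<^sup>2" for z
  define D where "D = closure \<Omega> \<inter> cball x r"
  have inS: "\<bar>z $ k - x $ k\<bar> \<le> r" if "z \<in> cball x r" for z
    using component_le_norm_cart[of "z - x" k] that by (simp add: dist_norm norm_minus_commute)
  have DS: "D \<subseteq> ?S"
  proof
    fix z assume "z \<in> D"
    then have "\<bar>z $ k - x $ k\<bar> \<le> r" using inS by (auto simp: D_def)
    moreover have "l - x $ k = 4 * r" by (simp add: r_def)
    ultimately have "z $ k < l" using r by linarith
    then show "z \<in> ?S" by (simp add: left_half_space_def)
  qed
  have "lower_semicontinuous_on D (\<lambda>z. w z + - (\<epsilon> * q z))"
    using r by (intro lower_semicontinuous_on_add_continuous lower_semicontinuous_on_subset[OF lsc])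
      (auto simp: D_def q_def intro!: continuous_intros)
  moreover have "compact D" unfolding D_def by (simp add: closed_Int_compact)
  moreover have xD: "x \<in> D" using x(1) closure_subset[of \<Omega>] r by (auto simp: D_def)
  ultimately obtain y where y: "y \<in> D" "\<And>z. z \<in> D \<Longrightarrow> w y - \<epsilon> * q y \<le> w z - \<epsilon> * q z"
    using lower_semicontinuous_on_attains_inf[of D "\<lambda>z. w z + - (\<epsilon> * q z)"] by auto
  have q1: "q z \<le> 1" for z by (simp add: q_def)
  then have \<epsilon>q: "\<epsilon> * q z \<le> \<epsilon>" for z using \<epsilon>(1) by (simp add: mult_left_le)
  have "w y - \<epsilon> * q y \<le> w x - \<epsilon>" using y(2)[OF xD] by (simp add: q_def)
  \<comment> \<open>At \<open>y\<close> the perturbed function is strictly below the infimum of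
    \<open>w\<close>. Hence \<open>q y\<close> is positive, and \<open>y\<close> lies in the open
    ball.\<close>
  with x(2) have vy: "w y - \<epsilon> * q y < m" by simp
  have wy: "w y < m + \<epsilon>" using vy \<epsilon>q[of y] by simp
  have yS: "y \<in> ?S" using y DS by auto
  \<comment> \<open>The minimum was taken over part of the closure, so boundary points of
    \<open>\<Omega>\<close> inside the half space have to be excluded; there \<open>w\<close> is
    nonnegative.\<close>
  have y\<Omega>: "y \<in> \<Omega>"
  proof (rule ccontr)
    assume "y \<notin> \<Omega>"
    then have "0 \<le> w y" using nonneg yS by auto
    then show False using wy \<epsilon> m by linarith
  qed
  have "0 < \<epsilon> * q y" using vy m_le[OF y\<Omega>] by linarith
  then have "0 < q y" using \<epsilon>(1) by (simp add: zero_less_mult_iff)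
  then have "(norm (y - x))\<^sup>2 < r\<^sup>2" using r by (simp add: q_def field_simps)
  then have yx: "norm (y - x) < r" using r by (simp add: power2_less_imp_less)
  have diff: "w y - w z \<le> \<epsilon> * (q y - q z)" if z: "z \<in> ?S" for z
  proof -
    \<comment> \<open>Minimality extends from \<open>D\<close> to the half space: off the ball
      \<open>q\<close> is at most 0 and \<open>w\<close> at least \<open>m\<close>; off the closure
      the perturbed value is at least \<open>- \<epsilon>\<close>, which exceeds
      \<open>m\<close>.\<close>
    consider "z \<in> D" | "z \<notin> cball x r" | "z \<notin> closure \<Omega>" unfolding D_def by blast
    then have "w y - \<epsilon> * q y \<le> w z - \<epsilon> * q z"
    proof cases
      case 1 then show ?thesis by (rule y(2))
    next
      case 2
      then have "r\<^sup>2 \<le> (norm (z - x))\<^sup>2" using r by (intro power_mono) (auto simp: dist_norm norm_minus_commute)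
      then have "q z \<le> 0" using r by (simp add: q_def field_simps)
      then have "\<epsilon> * q z \<le> 0" using \<epsilon>(1) by (simp add: mult_nonneg_nonpos)
      then show ?thesis using vy m_le'[OF z] by linarith
    next
      case 3
      then have "0 \<le> w z" using nonneg z closure_subset[of \<Omega>] by auto
      then show ?thesis using vy \<epsilon>q[of z] \<epsilon> m by linarith
    qed
    then show ?thesis by (simp add: right_diff_distrib)
  qed
  \<comment> \<open>Minus the gradient of \<open>q\<close> at \<open>y\<close>; as \<open>q\<close>
    is quadratic, the expansion below is exact.\<close>
  define g where "g = (2 / r\<^sup>2) *\<^sub>R (y - x)"
  have qq: "q y - q z = g \<bullet> (z - y) + (1 / r\<^sup>2) * (norm (y - z))\<^sup>2" for z
  proof -
    have "z - x = (y - x) + (z - y)" by simp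
    then have "(norm (z - x))\<^sup>2 = (norm (y - x))\<^sup>2 + 2 * ((y - x) \<bullet> (z - y)) + (norm (y - z))\<^sup>2"
      by (simp only: power2_norm_eq_inner) (simp add: inner_simps inner_commute)
    moreover have "g \<bullet> (z - y) = 2 * ((y - x) \<bullet> (z - y)) / r\<^sup>2" by (simp add: g_def)
    ultimately show ?thesis by (simp add: q_def add_divide_distrib)
  qed
  show thesis
  proof (rule that[of y r \<epsilon> g])
    have "\<bar>y $ k - x $ k\<bar> \<le> r" using y(1) inS by (auto simp: D_def)
    moreover have "l - x $ k = 4 * r" by (simp add: r_def)
    ultimately show "3 * r \<le> l - y $ k" "l - y $ k \<le> 5 * r" by linarith+
    show "w y < 0" using wy \<epsilon> m by linarith
    show "3 * \<epsilon> \<le> - w y" using wy \<epsilon> m by linarith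
    \<comment> \<open>Replaces \<open>m\<close> by the value at the touching point:
      \<open>w y\<close> is below \<open>7 / 8 * m\<close>.\<close>
    have "- m \<le> - (2 * w y)" using wy \<epsilon> m by linarith
    then have "\<theta> * (- m) \<le> \<theta> * (- (2 * w y))" using \<theta> by (intro mult_left_mono) auto
    then show "\<epsilon> \<le> - (2 * \<theta> * w y)" by (simp add: \<epsilon>_def mult_ac)
    show "w y - w z \<le> \<epsilon> * (g \<bullet> (z - y) + (1 / r\<^sup>2) * (norm (y - z))\<^sup>2)" if "z \<in> ?S" for z
      using diff[OF that] by (simp add: qq)
    show "- 3 \<le> g \<bullet> (z - y) + (1 / r\<^sup>2) * (norm (y - z))\<^sup>2" if "z \<in> ball y r" for z
      unfolding qq[symmetric] using q1[of z] \<open>0 < q y\<close> by linarith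
    show "w y - w z \<le> \<epsilon>" if "z \<in> ?S" for z using wy m_le'[OF that] by linarith
  qed (use y\<Omega> r \<epsilon> in auto)
qed

subsection \<open>The narrow region principle\<close>

text \<open>The width \<open>\<delta>\<^sub>0\<close> is fixed before the region and the functions;
  the value constructed depends only on the dimension, \<alpha> and the lower bound \<open>K\<close>
  of \<open>c\<close>.\<close>

theorem theorem2:
  fixes \<alpha> l K :: real and k :: "'n::finite"
  assumes "0 < \<alpha>" and "\<alpha> < 2"
  shows "\<exists>\<delta>\<^sub>0>0. \<forall>\<delta>. 0 < \<delta> \<and> \<delta> \<le> \<delta>\<^sub>0 \<longrightarrow>
    (\<forall>(\<Omega> :: (real ^ 'n) set) (w :: real ^ 'n \<Rightarrow> real) (c :: real ^ 'n \<Rightarrow> real).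
       open \<Omega> \<and>
       \<Omega> \<subseteq> left_half_space k l \<and>
       \<Omega> \<subseteq> {x. l - \<delta> < x $ k \<and> x $ k < l} \<and>
       (bounded \<Omega> \<or> Liminf at_infinity (\<lambda>x. ereal (w x)) \<ge> 0) \<and>
       w \<in> L_space \<alpha> \<inter> C11_loc \<Omega> \<and>
       lower_semicontinuous_on (closure \<Omega>) w \<and>
       (\<forall>x\<in>\<Omega>. K \<le> c x) \<and>
       (\<forall>x\<in>\<Omega>. frac_laplacian \<alpha> w x + c x * w x \<ge> 0) \<and>
       (\<forall>x\<in>left_half_space k l - \<Omega>. w x \<ge> 0) \<and>
       (\<forall>x\<in>left_half_space k l. w (plane_reflect k l x) = - w x)
       \<longrightarrow> (\<forall>x\<in>\<Omega>. w x \<ge> 0) \<and>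
           ((\<exists>x\<in>\<Omega>. w x = 0) \<longrightarrow> (AE x in lebesgue. w x = 0)))"
proof -
  define p where "p = real CARD('n) + \<alpha>"
  obtain C\<^sub>1 where C\<^sub>1: "0 \<le> C\<^sub>1" "\<And>(y :: real ^ 'n) s. 0 < s \<Longrightarrow>
      set_integrable lebesgue (- ball y s) (riesz_kernel p y) \<and>
      (LINT z : - ball y s | lebesgue. riesz_kernel p y z) \<le> C\<^sub>1 * s powr - \<alpha>"
    using riesz_kernel_tail_integral[OF assms(1), where 'a = "real ^ 'n"] by (auto simp: p_def)
  obtain C\<^sub>2 where C\<^sub>2: "0 \<le> C\<^sub>2" "\<And>(y :: real ^ 'n) s. 0 < s \<Longrightarrow>
      set_integrable lebesgue (ball y s) (\<lambda>z. (norm (y - z))\<^sup>2 * riesz_kernel p y z) \<and>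
      (LINT z : ball y s | lebesgue. (norm (y - z))\<^sup>2 * riesz_kernel p y z) \<le> C\<^sub>2 * s powr (2 - \<alpha>)"
    using riesz_kernel_second_moment[OF assms, where 'a = "real ^ 'n"] by (auto simp: p_def)
  define N where "N = frac_laplacian_const CARD('n) \<alpha>"
  have N: "0 < N" unfolding N_def by (rule frac_laplacian_const_pos[OF assms])
  \<comment> \<open>The constant of the reflected mass; the extra \<open>5 powr - \<alpha>\<close>
    converts the distance to the hyperplane, at most \<open>5 * r\<close>, into
    \<open>r\<close>.\<close>
  define M where "M = unit_ball_vol CARD('n) * 5 powr - p * 5 powr - \<alpha>"
  have M: "0 < M" by (simp add: M_def)
  \<comment> \<open>Makes the error at most half of the main term; the summand 1 keeps the
    denominator positive.\<close>
  define \<theta> where "\<theta> = min (1 / 8) (M / (4 * (C\<^sub>1 + C\<^sub>2 + 1)))"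
  have \<theta>: "0 < \<theta>" "\<theta> \<le> 1 / 8"
    using M C\<^sub>1(1) C\<^sub>2(1) unfolding \<theta>_def by (simp, intro min.cobounded1)
  have "\<theta> * (C\<^sub>1 + C\<^sub>2) \<le> M / (4 * (C\<^sub>1 + C\<^sub>2 + 1)) * (C\<^sub>1 + C\<^sub>2 + 1)"
    using M C\<^sub>1(1) C\<^sub>2(1) by (intro mult_mono) (auto simp: \<theta>_def)
  also have "\<dots> = M / 4" using C\<^sub>1(1) C\<^sub>2(1) by (simp add: field_simps)
  finally have \<theta>C: "2 * \<theta> * (C\<^sub>1 + C\<^sub>2) \<le> M / 2" by simp
  \<comment> \<open>Solves \<open>N * (M / 2) * \<delta>\<^sub>0 powr - \<alpha> = \<bar>K\<bar> +
    1\<close>; the excess 1 over \<open>\<bar>K\<bar>\<close> produces the final strict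
    contradiction.\<close>
  define \<delta>\<^sub>0 where "\<delta>\<^sub>0 = (N * M / 2 / (\<bar>K\<bar> + 1)) powr (1 / \<alpha>)"
  have \<delta>\<^sub>0: "0 < \<delta>\<^sub>0" using N M by (simp add: \<delta>\<^sub>0_def)
  have \<delta>\<^sub>0_powr: "N * (M / 2) * \<delta>\<^sub>0 powr - \<alpha> = \<bar>K\<bar> + 1"
    using N M assms by (simp add: \<delta>\<^sub>0_def powr_powr powr_minus_divide)
  show ?thesis
  proof (rule exI[of _ \<delta>\<^sub>0], rule conjI[OF \<delta>\<^sub>0], intro allI impI, elim conjE)
    fix \<delta> and \<Omega> :: "(real ^ 'n) set" and w c :: "real ^ 'n \<Rightarrow> real"
    assume \<delta>: "0 < \<delta>" "\<delta> \<le> \<delta>\<^sub>0" and op: "open \<Omega>" and sub: "\<Omega> \<subseteq> left_half_space k l"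
      and narrow: "\<Omega> \<subseteq> {x. l - \<delta> < x $ k \<and> x $ k < l}"
      and bd: "bounded \<Omega> \<or> Liminf at_infinity (\<lambda>x. ereal (w x)) \<ge> 0"
      and "w \<in> L_space \<alpha> \<inter> C11_loc \<Omega>"
      and lsc: "lower_semicontinuous_on (closure \<Omega>) w" and c: "\<forall>x\<in>\<Omega>. K \<le> c x"
      and eq: "\<forall>x\<in>\<Omega>. frac_laplacian \<alpha> w x + c x * w x \<ge> 0"
      and nonneg: "\<forall>x\<in>left_half_space k l - \<Omega>. w x \<ge> 0"
      and anti': "\<forall>x\<in>left_half_space k l. w (plane_reflect k l x) = - w x"
    from \<open>w \<in> L_space \<alpha> \<inter> C11_loc \<Omega>\<close> have w: "w \<in> L_space \<alpha>" "w \<in> C11_loc \<Omega>" by auto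
    note anti = anti'[rule_format]
    have limit: "\<exists>L. (truncated_pv p w y \<longlongrightarrow> L) (at_right 0) \<and> frac_laplacian \<alpha> w y = N * L" if "y \<in> \<Omega>" for y
    proof -
      obtain r g C where "0 < r" "\<And>z. z \<in> ball y r \<Longrightarrow> \<bar>w z - w y - g \<bullet> (z - y)\<bar> \<le> C * (norm (y - z))\<^sup>2"
        using C11_loc_taylor[OF w(2) op \<open>y \<in> \<Omega>\<close>] by metis
      from truncated_pv_convergent[OF w(1) assms this] obtain L
        where "(truncated_pv p w y \<longlongrightarrow> L) (at_right 0)" unfolding p_def by blast
      then show ?thesis using frac_laplacian_eq_limit[of \<alpha> w y L] by (auto simp: p_def N_def)
    qed
    have pos: "0 \<le> w x" if "x \<in> \<Omega>" for x
    proof (rule ccontr)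
      assume "\<not> 0 \<le> w x"
      then have neg: "w x < 0" by simp
      have bdd: "bdd_below (w ` \<Omega>)" by (rule lower_semicontinuous_on_closure_bdd_below[OF lsc bd])
      obtain y r \<epsilon> g where y: "y \<in> \<Omega>" and r: "0 < r" "3 * r \<le> l - y $ k" "l - y $ k \<le> 5 * r"
        and wy: "w y < 0" and \<epsilon>: "0 < \<epsilon>" "\<epsilon> \<le> - (2 * \<theta> * w y)" "3 * \<epsilon> \<le> - w y"
        and near: "\<And>z. z \<in> left_half_space k l \<Longrightarrow> w y - w z \<le> \<epsilon> * (g \<bullet> (z - y) + (1 / r\<^sup>2) * (norm (y - z))\<^sup>2)"
        and small: "\<And>z. z \<in> ball y r \<Longrightarrow> - 3 \<le> g \<bullet> (z - y) + (1 / r\<^sup>2) * (norm (y - z))\<^sup>2"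
        and far: "\<And>z. z \<in> left_half_space k l \<Longrightarrow> w y - w z \<le> \<epsilon>"
        using touching_point[OF sub lsc bdd nonneg[rule_format] \<open>x \<in> \<Omega>\<close> neg \<theta>] by metis
      obtain L where L: "(truncated_pv p w y \<longlongrightarrow> L) (at_right 0)" "frac_laplacian \<alpha> w y = N * L"
        using limit[OF y] by blast
      have yS: "y \<in> left_half_space k l" using y sub by auto
      have "L \<le> \<epsilon> * (C\<^sub>1 * r powr - \<alpha> + (1 / r\<^sup>2) * (C\<^sub>2 * r powr (2 - \<alpha>)))
          + w y * (unit_ball_vol CARD('n) * 5 powr - p * (l - y $ k) powr - \<alpha>)"
        unfolding p_def
        by (rule truncated_pv_upper_bound[OF w(1) assms(1) yS anti, where s = r and \<kappa> = "1 / r\<^sup>2" and g = g])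
          (use r \<epsilon> near small far L(1) C\<^sub>1(2)[OF r(1), of y] C\<^sub>2(2)[OF r(1), of y] in \<open>simp_all add: p_def\<close>)
      \<comment> \<open>With curvature \<open>1 / r\<^sup>2\<close> the quadratic error scales
        exactly like the tail and the main term.\<close>
      also have "(1 / r\<^sup>2) * (C\<^sub>2 * r powr (2 - \<alpha>)) = C\<^sub>2 * r powr - \<alpha>"
        using r(1) by (simp add: powr_diff powr_minus_divide)
      also have "w y * (unit_ball_vol CARD('n) * 5 powr - p * (l - y $ k) powr - \<alpha>) \<le> w y * (M * r powr - \<alpha>)"
      proof (rule mult_left_mono_neg)
        have "M * r powr - \<alpha> = unit_ball_vol CARD('n) * 5 powr - p * (5 * r) powr - \<alpha>"
          using r(1) by (simp add: M_def powr_mult mult_ac)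
        also have "\<dots> \<le> unit_ball_vol CARD('n) * 5 powr - p * (l - y $ k) powr - \<alpha>"
          using r assms(1) by (intro mult_left_mono powr_mono2') auto
        finally show "M * r powr - \<alpha> \<le> unit_ball_vol CARD('n) * 5 powr - p * (l - y $ k) powr - \<alpha>" .
      qed (use wy in simp)
      also have "\<epsilon> * (C\<^sub>1 * r powr - \<alpha> + C\<^sub>2 * r powr - \<alpha>) + w y * (M * r powr - \<alpha>)
          = (\<epsilon> * (C\<^sub>1 + C\<^sub>2) + w y * M) * r powr - \<alpha>" by (simp add: algebra_simps)
      also have "\<dots> \<le> (w y * (M / 2)) * r powr - \<alpha>"
      proof (rule mult_right_mono)
        have "\<epsilon> * (C\<^sub>1 + C\<^sub>2) \<le> - (2 * \<theta> * w y) * (C\<^sub>1 + C\<^sub>2)"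
          using \<epsilon>(2) C\<^sub>1(1) C\<^sub>2(1) by (intro mult_right_mono) auto
        also have "\<dots> = (- w y) * (2 * \<theta> * (C\<^sub>1 + C\<^sub>2))" by (simp add: algebra_simps)
        also have "\<dots> \<le> (- w y) * (M / 2)" using \<theta>C wy by (intro mult_left_mono) auto
        finally show "\<epsilon> * (C\<^sub>1 + C\<^sub>2) + w y * M \<le> w y * (M / 2)" by (simp add: field_simps)
      qed simp
      also have "\<dots> \<le> (w y * (M / 2)) * \<delta>\<^sub>0 powr - \<alpha>"
      proof (rule mult_left_mono_neg)
        \<comment> \<open>Narrowness enters here, through \<open>3 * r \<le> l - y $ k\<close> and
          \<open>l - y $ k < \<delta>\<close>.\<close>
        have "r \<le> \<delta>\<^sub>0" using y narrow r \<delta> by auto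
        then show "\<delta>\<^sub>0 powr - \<alpha> \<le> r powr - \<alpha>" using r(1) assms(1) by (intro powr_mono2') auto
      qed (use wy M in \<open>simp add: mult_nonpos_nonneg\<close>)
      finally have "N * L \<le> N * ((w y * (M / 2)) * \<delta>\<^sub>0 powr - \<alpha>)" using N by simp
      also have "\<dots> = w y * (N * (M / 2) * \<delta>\<^sub>0 powr - \<alpha>)" by (simp add: mult_ac)
      finally have "N * L \<le> w y * (\<bar>K\<bar> + 1)" unfolding \<delta>\<^sub>0_powr .
      \<comment> \<open>From \<open>c y \<ge> - \<bar>K\<bar>\<close>, reversed by the negative
        factor \<open>w y\<close>.\<close>
      moreover have "c y * w y \<le> - \<bar>K\<bar> * w y"
        using c y wy by (intro mult_right_mono_neg) force+
      ultimately have "N * L + c y * w y \<le> w y" by (simp add: algebra_simps)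
      then show False using eq y wy L(2) by force
    qed
    have posS: "0 \<le> w z" if "z \<in> left_half_space k l" for z
      using pos nonneg that by (cases "z \<in> \<Omega>") auto
    show "(\<forall>x\<in>\<Omega>. w x \<ge> 0) \<and> ((\<exists>x\<in>\<Omega>. w x = 0) \<longrightarrow> (AE x in lebesgue. w x = 0))"
    proof (intro conjI ballI impI pos)
      assume "\<exists>x\<in>\<Omega>. w x = 0"
      then obtain y where y: "y \<in> \<Omega>" "w y = 0" by blast
      obtain L where L: "(truncated_pv p w y \<longlongrightarrow> L) (at_right 0)" "frac_laplacian \<alpha> w y = N * L"
        using limit[OF y(1)] by blast
      have "0 \<le> N * L" using eq y L(2) by force
      then have "0 \<le> L" using N by (simp add: zero_le_mult_iff)
      moreover have "y \<in> left_half_space k l" using y sub by auto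
      ultimately show "AE x in lebesgue. w x = 0"
        using antisymmetric_eq_0_of_truncated_pv[OF w(1) assms(1) _ anti posS y(2)] L(1) by (simp add: p_def)
    qed
  qed
qed

end
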